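(* Let $N>2$ and let $P$ be an irreducible and aperiodic transition matrix on $[N]=\{1,\dots,N\}$ with stationary distribution $\pi^*$. Run the RLGL algorithm with $P$ and green-light sets $G_t=\{U_t\}$, $t\ge1$, where $U_1,U_2,\dots$ are independent random variables with uniform distribution on $\{1,2,\dots,N\}$. Let $\eta\in(0,1)$ and $r\ge1$ (an integer) be such that $$(P^{r'})_{ij}>\eta\quad\text{for all } r'>r \text{ and } i,j\in[N].$$ Then for any $f(t)>0$ such that $\lim_{t\to\infty}f(t)=\infty$, $$\mathbb{P}\left(\|C_t\|_1\le f(t)e^{-at}\right)=1-o(1)\quad\text{as } t\to\infty,$$ where $$a=\sup_{\beta\in(0,(Nr)^{-1})}\min\left\{\beta\,|\log(1-\tilde\eta)|,\ \beta J(\beta)\right\},\qquad \tilde\eta=\left(\tfrac12\right)^{r-1}\eta,$$ $$J(\beta)=\beta^{-1}(1-2r\beta)\log\left(\frac{N(1-2r\beta)}{N-2}\right)+2r\log(Nr\beta).$$ If, in addition, $\inf_{t>0}|H_t\mathbf{1}|>0$ (almost surely), then $\|\hat\pi_t-\pi^*\|_1=O_{\mathbb{P}}\left(f(t)e^{-at}\right)$ as $t\to\infty$.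
   Context: All vectors indexed by states are row vectors in $\mathbb{R}^N$; $\mathbf{1}$ is the column vector of ones; $\|\cdot\|_1$ is the sum of absolute values. RLGL algorithm. The input is a stochastic matrix $P$ and a sequence $\mathbf{G}=(G_0,G_1,\dots)$ of subsets of $[N]$ with $G_0=[N]$; the sets $G_t$, $t\ge1$, may be deterministic or random. For $G\subseteq[N]$ let $I(G)$ be the diagonal matrix with $I(G)_{ii}=1$ if $i\in G$ and all other entries $0$. Start with $C_0=\mathbf{0}$, $H_0=\mathbf{0}$, and $M_0$ a fixed probability distribution on $[N]$ (usually uniform). Recursively, $$M_t=C_tI(G_t)\ (t\ge1),\qquad H_{t+1}=H_t+M_t\ (t\ge0),\qquad C_{t+1}=C_t-M_t(I-P)\ (t\ge0).$$ The estimate of $\pi^*$ is $\hat\pi_t=H_t/(H_t\mathbf{1})$, $t\ge1$ (when $H_t\mathbf{1}\neq0$). For random $Y_t$ and deterministic $g(t)>0$, $Y_t=O_{\mathbb{P}}(g(t))$ as $t\to\infty$ means: for every $\epsilon>0$ there are $K,t_0<\infty$ such that $\mathbb{P}(|Y_t|>Kg(t))\le\epsilon$ for all $t\ge t_0$. *)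

theory Defs
  imports "HOL-Probability.Probability"
begin

(* Row vectors act on matrices from the left: (v v* A) $ j = (\<Sum>i. v $ i * A $ i $ j). *)

(* On real^'n^'n the operator ^ is the componentwise power. *)
primrec matpow :: "real^'n^'n \<Rightarrow> nat \<Rightarrow> real^'n^'n::finite" where
  "matpow A 0 = mat 1"
| "matpow A (Suc n) = matpow A n ** A"

definition stochastic_matrix :: "real^'n^'n::finite \<Rightarrow> bool" where
  "stochastic_matrix P \<longleftrightarrow> (\<forall>i j. 0 \<le> P $ i $ j) \<and> (\<forall>i. (\<Sum>j\<in>UNIV. P $ i $ j) = 1)"

definition irreducible_matrix :: "real^'n^'n::finite \<Rightarrow> bool" where
  "irreducible_matrix P \<longleftrightarrow> (\<forall>i j. \<exists>n. 0 < matpow P n $ i $ j)"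

definition aperiodic_matrix :: "real^'n^'n::finite \<Rightarrow> bool" where
  "aperiodic_matrix P \<longleftrightarrow> (\<forall>i. Gcd {n. 0 < n \<and> 0 < matpow P n $ i $ i} = 1)"

definition prob_vector :: "real^'n::finite \<Rightarrow> bool" where
  "prob_vector v \<longleftrightarrow> (\<forall>i. 0 \<le> v $ i) \<and> (\<Sum>i\<in>UNIV. v $ i) = 1"

definition stationary_distribution :: "real^'n^'n::finite \<Rightarrow> real^'n \<Rightarrow> bool" where
  "stationary_distribution P \<pi> \<longleftrightarrow> prob_vector \<pi> \<and> \<pi> v* P = \<pi>"

definition norm1 :: "real^'n::finite \<Rightarrow> real" where
  "norm1 v = (\<Sum>i\<in>UNIV. \<bar>v $ i\<bar>)"

definition entry_sum :: "real^'n::finite \<Rightarrow> real" where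
  "entry_sum v = (\<Sum>i\<in>UNIV. v $ i)"

definition indicator_matrix :: "'n::finite set \<Rightarrow> real^'n^'n" where
  "indicator_matrix G = (\<chi> i j. if i = j \<and> i \<in> G then 1 else 0)"

(* The set G 0 is never consulted: the first move is the prescribed M0. *)
function (sequential)
  rlgl_C :: "real^'n^'n \<Rightarrow> real^'n \<Rightarrow> (nat \<Rightarrow> 'n::finite set) \<Rightarrow> nat \<Rightarrow> real^'n" and
  rlgl_M :: "real^'n^'n \<Rightarrow> real^'n \<Rightarrow> (nat \<Rightarrow> 'n::finite set) \<Rightarrow> nat \<Rightarrow> real^'n"
where
  "rlgl_C P M0 G 0 = 0"
| "rlgl_C P M0 G (Suc t) = rlgl_C P M0 G t - rlgl_M P M0 G t v* (mat 1 - P)"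
| "rlgl_M P M0 G 0 = M0"
| "rlgl_M P M0 G (Suc t) = rlgl_C P M0 G (Suc t) v* indicator_matrix (G (Suc t))"
  by pat_completeness auto
termination
  by (relation "Wellfounded.measure (case_sum (\<lambda>(P, M0, G, t). 2 * t) (\<lambda>(P, M0, G, t). 2 * t + 1))") auto

primrec rlgl_H :: "real^'n^'n \<Rightarrow> real^'n \<Rightarrow> (nat \<Rightarrow> 'n::finite set) \<Rightarrow> nat \<Rightarrow> real^'n" where
  "rlgl_H P M0 G 0 = 0"
| "rlgl_H P M0 G (Suc t) = rlgl_H P M0 G t + rlgl_M P M0 G t"

definition rlgl_estimate :: "real^'n^'n \<Rightarrow> real^'n \<Rightarrow> (nat \<Rightarrow> 'n::finite set) \<Rightarrow> nat \<Rightarrow> real^'n" where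
  "rlgl_estimate P M0 G t = (1 / entry_sum (rlgl_H P M0 G t)) *\<^sub>R rlgl_H P M0 G t"

definition single_green :: "(nat \<Rightarrow> 'w \<Rightarrow> 'n) \<Rightarrow> 'w \<Rightarrow> nat \<Rightarrow> 'n set" where
  "single_green U \<omega> t = (if t = 0 then UNIV else {U t \<omega>})"

definition bigO_prob :: "'w measure \<Rightarrow> (nat \<Rightarrow> 'w \<Rightarrow> real) \<Rightarrow> (nat \<Rightarrow> real) \<Rightarrow> bool" where
  "bigO_prob \<Omega> Y g \<longleftrightarrow>
     (\<forall>\<epsilon>>0. \<exists>K t0. \<forall>t\<ge>t0. measure \<Omega> {\<omega> \<in> space \<Omega>. \<bar>Y t \<omega>\<bar> > K * g t} \<le> \<epsilon>)"

definition rate_J :: "nat \<Rightarrow> nat \<Rightarrow> real \<Rightarrow> real" where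
  "rate_J N r \<beta> =
     1 / \<beta> * (1 - 2 * real r * \<beta>) * ln (real N * (1 - 2 * real r * \<beta>) / (real N - 2))
     + 2 * real r * ln (real N * real r * \<beta>)"

definition eta_tilde :: "nat \<Rightarrow> real \<Rightarrow> real" where
  "eta_tilde r \<eta> = (1 / 2) ^ (r - 1) * \<eta>"

(* For r \<ge> 1, N > 2 and 0 < \<eta> < 1 the supremum is over a nonempty set bounded above. *)
definition rate :: "nat \<Rightarrow> nat \<Rightarrow> real \<Rightarrow> real" where
  "rate N r \<eta> =
     (SUP \<beta>\<in>{0<..<1 / (real N * real r)}.
        min (\<beta> * \<bar>ln (1 - eta_tilde r \<eta>)\<bar>) (\<beta> * rate_J N r \<beta>))"

end

theory Submission
  imports Defs
begin

text \<open>Two unit cash packets of opposite sign at i and j, moved by the common green lights, behave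
  as two walkers with transition matrix P that annihilate when they meet; in each step one of the two
  jumps with probability 2/N. All cash vectors are zero-sum, hence mixtures of such pairs, so the
  expected norm of the cash is at most twice the probability that the walkers are still apart.

  After n jumps this probability is at most C \<rho>^n with \<rho>^(2r) = 1 - eta_tilde. Indeed, of 2r+1
  jumps one walker makes more than r, which forces a meeting with probability \<eta>; this suffices for
  r \<ge> 2. For r = 1 one uses instead that from any two distinct places the walkers meet exactly at
  the second jump with probability at least \<eta>/2. Since the number of jumps in t steps is
  binomial, the expected norm is O((1 - p + p \<rho>)^t) with p = 2/N, and the Legendre duality of this
  moment generating function with the Bernoulli relative entropy gives
  a \<le> - ln (1 - p + p \<rho>). Markov's inequality absorbs the constant in f.

  For the estimate, H(I - P) = - C, and I - P is boundedly invertible on zero-sum vectors.\<close>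

section \<open>Cash vectors as mixtures of annihilating walkers\<close>

text \<open>Closed form of \<open>C - M (I - P)\<close> for the move \<open>M\<close> that takes all
  the cash at \<open>u\<close>: this entry is spread along row \<open>u\<close> of
  \<open>P\<close>.\<close>

definition rlgl_step :: "real^'n^'n \<Rightarrow> 'n \<Rightarrow> real^'n \<Rightarrow> real^'n::finite" where
  "rlgl_step P u v = v + v $ u *\<^sub>R (P $ u - axis u 1)"

text \<open>The expected norm of the cash after \<open>t\<close> further uniform green lights, as a
  finite recursion instead of an integral; \<open>expectation_mean_norm1\<close> identifies the
  two.\<close>

primrec mean_norm1 :: "real^'n^'n \<Rightarrow> nat \<Rightarrow> real^'n::finite \<Rightarrow> real" where
  "mean_norm1 P 0 v = norm1 v"
| "mean_norm1 P (Suc t) v = (\<Sum>u\<in>UNIV. mean_norm1 P t (rlgl_step P u v)) / CARD('n)"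

section \<open>One green light as a linear map on cash vectors\<close>

lemma vector_matrix_mult_indicator_singleton:
  "v v* indicator_matrix {u} = v $ u *\<^sub>R axis u 1"
proof (rule vec_eq_iff[THEN iffD2], rule allI)
  fix j
  have "(\<Sum>i\<in>UNIV. v $ i * (if i = j \<and> i = u then 1 else 0))
    = (\<Sum>i\<in>UNIV. if i = u then (if j = u then v $ u else 0) else 0)"
    by (intro sum.cong) auto
  then show "(v v* indicator_matrix {u}) $ j = (v $ u *\<^sub>R axis u 1) $ j"
    by (simp add: vector_matrix_mult_def indicator_matrix_def axis_def mult.commute)
qed

lemma rlgl_M_single_green:
  assumes "t \<ge> 1"
  shows "rlgl_M P M0 (single_green U \<omega>) t
    = rlgl_C P M0 (single_green U \<omega>) t $ U t \<omega> *\<^sub>R axis (U t \<omega>) 1"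
proof -
  obtain s where "t = Suc s" using assms by (cases t) auto
  then show ?thesis
    by (simp add: vector_matrix_mult_indicator_singleton single_green_def del: rlgl_C.simps)
qed

lemma axis_vector_matrix_mult:
  fixes A :: "real^'n::finite^'m::finite"
  shows "axis u 1 v* A = A $ u"
  by (simp add: vec_eq_iff vector_matrix_mult_def axis_def if_distrib[of "\<lambda>x. x * _"] if_distrib[of "\<lambda>x. _ * x"] cong: if_cong)

lemma mat_nth: "(mat 1 :: real^'n::finite^'n) $ u = axis u 1"
  by (auto simp: vec_eq_iff mat_def axis_def)

text \<open>The condition on \<open>t\<close> excludes the move at time 0, which is
  \<open>M0\<close> and not of this form.\<close>

lemma rlgl_C_Suc_single_green:
  assumes "t \<ge> 1"
  shows "rlgl_C P M0 (single_green U \<omega>) (Suc t)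
    = rlgl_step P (U t \<omega>) (rlgl_C P M0 (single_green U \<omega>) t)"
  by (simp only: rlgl_C.simps rlgl_M_single_green[OF assms] rlgl_step_def scaleR_vector_matrix_assoc)
     (simp add: axis_vector_matrix_mult mat_nth algebra_simps)

lemma rlgl_step_add: "rlgl_step P u (v + w) = rlgl_step P u v + rlgl_step P u w"
  by (simp add: rlgl_step_def algebra_simps)

lemma rlgl_step_scaleR: "rlgl_step P u (c *\<^sub>R v) = c *\<^sub>R rlgl_step P u v"
  by (simp add: rlgl_step_def algebra_simps)

text \<open>Every step is linear in the cash, so subadditivity of the norm survives the averaging.
  This allows mixtures of cash vectors to be treated piece by piece.\<close>

lemma mean_norm1_add_le: "mean_norm1 P t (v + w) \<le> mean_norm1 P t v + mean_norm1 P t w"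
proof (induction t arbitrary: v w)
  case 0
  then show ?case by (simp add: norm1_def sum.distrib[symmetric] sum_mono abs_triangle_ineq)
next
  case (Suc t)
  then show ?case
    by (simp add: rlgl_step_add add_divide_distrib[symmetric] sum.distrib[symmetric] divide_right_mono sum_mono)
qed

lemma mean_norm1_scaleR: "mean_norm1 P t (c *\<^sub>R v) = \<bar>c\<bar> * mean_norm1 P t v"
  by (induction t arbitrary: v)
     (simp_all add: rlgl_step_scaleR norm1_def abs_mult sum_distrib_left)

lemma mean_norm1_zero [simp]: "mean_norm1 P t 0 = 0"
  using mean_norm1_scaleR[of P t 0 0] by simp

lemma mean_norm1_sum_le:
  assumes "\<And>k. k \<in> S \<Longrightarrow> c k \<ge> 0"
  shows "mean_norm1 P t (\<Sum>k\<in>S. c k *\<^sub>R w k) \<le> (\<Sum>k\<in>S. c k * mean_norm1 P t (w k))"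
  using assms
proof (induction S rule: infinite_finite_induct)
  case (insert x S)
  then show ?case
    using mean_norm1_add_le[of P t "c x *\<^sub>R w x" "\<Sum>k\<in>S. c k *\<^sub>R w k"]
    by (simp add: mean_norm1_scaleR)
qed auto

text \<open>The generator of the annihilating walkers: one of them, chosen with equal odds, jumps, and
  nothing survives on the diagonal.\<close>

definition killed :: "real^'n^'n \<Rightarrow> ('n \<Rightarrow> 'n \<Rightarrow> real) \<Rightarrow> 'n::finite \<Rightarrow> 'n \<Rightarrow> real" where
  "killed P g i j = (if i = j then 0
     else ((\<Sum>k\<in>UNIV. P $ i $ k * g k j) + (\<Sum>k\<in>UNIV. P $ j $ k * g i k)) / 2)"

text \<open>\<open>(killed P ^^ n) apart i j\<close> is the probability that walkers from
  \<open>i\<close> and \<open>j\<close> have not met within \<open>n\<close> jumps.\<close>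

definition apart :: "'n \<Rightarrow> 'n \<Rightarrow> real" where
  "apart i j = (if i = j then 0 else 1)"

text \<open>One unit of time: with probability \<open>p\<close> one of the two walkers jumps,
  otherwise the green light is elsewhere and nothing changes.\<close>

definition lazy_killed :: "real \<Rightarrow> real^'n^'n \<Rightarrow> ('n \<Rightarrow> 'n \<Rightarrow> real) \<Rightarrow> 'n::finite \<Rightarrow> 'n \<Rightarrow> real" where
  "lazy_killed p P g i j = (1 - p) * g i j + p * killed P g i j"

section \<open>Monotonicity and linearity of the walker operators\<close>

lemma killed_mono:
  assumes "stochastic_matrix P" "\<And>i j. f i j \<le> g i j"
  shows "killed P f i j \<le> killed P g i j"
  using assms by (auto simp: killed_def stochastic_matrix_def intro!: add_mono sum_mono mult_left_mono)

lemma killed_lincomb: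
  "killed P (\<lambda>i j. a * f i j + b * g i j) = (\<lambda>i j. a * killed P f i j + b * killed P g i j)"
  by (simp add: killed_def fun_eq_iff sum.distrib distrib_left sum_distrib_left algebra_simps
      add_divide_distrib)

lemma killed_pow_lincomb:
  "(killed P ^^ n) (\<lambda>i j. a * f i j + b * g i j)
    = (\<lambda>i j. a * (killed P ^^ n) f i j + b * (killed P ^^ n) g i j)"
  by (induction n) (simp_all add: killed_lincomb)

lemma killed_pow_mono:
  assumes "stochastic_matrix P" "\<And>i j. f i j \<le> g i j"
  shows "(killed P ^^ n) f i j \<le> (killed P ^^ n) g i j"
  by (induction n arbitrary: i j) (auto intro!: killed_mono assms)

lemma lazy_killed_mono:
  assumes "stochastic_matrix P" "0 \<le> p" "p \<le> 1" "\<And>i j. f i j \<le> g i j"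
  shows "lazy_killed p P f i j \<le> lazy_killed p P g i j"
  unfolding lazy_killed_def
  by (intro add_mono mult_left_mono killed_mono) (use assms in auto)

lemma lazy_killed_lincomb:
  "lazy_killed p P (\<lambda>i j. a * f i j + b * g i j)
    = (\<lambda>i j. a * lazy_killed p P f i j + b * lazy_killed p P g i j)"
  by (simp add: lazy_killed_def killed_lincomb fun_eq_iff algebra_simps)

lemma lazy_killed_pow_lincomb:
  "(lazy_killed p P ^^ n) (\<lambda>i j. a * f i j + b * g i j)
    = (\<lambda>i j. a * (lazy_killed p P ^^ n) f i j + b * (lazy_killed p P ^^ n) g i j)"
  by (induction n) (simp_all add: lazy_killed_lincomb)

text \<open>The number of jumps in \<open>t\<close> steps is binomial, and the mean of
  \<open>\<rho>\<close> to that number is \<open>(1 - p + p * \<rho>) ^ t\<close>. The induction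
  peels off the innermost operator, which mixes the iterates \<open>n\<close> and
  \<open>Suc n\<close>; hence the general \<open>n\<close>.\<close>

lemma lazy_killed_pow_le:
  assumes "0 \<le> p" "p \<le> 1" and le: "\<And>n i j. (killed P ^^ n) f i j \<le> C * \<rho> ^ n"
  shows "(lazy_killed p P ^^ t) ((killed P ^^ n) f) i j \<le> C * \<rho> ^ n * (1 - p + p * \<rho>) ^ t"
proof (induction t arbitrary: n)
  case 0
  then show ?case using le by simp
next
  case (Suc t)
  have "(lazy_killed p P ^^ Suc t) ((killed P ^^ n) f) i j
    = (lazy_killed p P ^^ t) (lazy_killed p P ((killed P ^^ n) f)) i j"
    by (simp only: funpow_Suc_right o_def)
  also have "lazy_killed p P ((killed P ^^ n) f)
    = (\<lambda>i j. (1 - p) * (killed P ^^ n) f i j + p * (killed P ^^ Suc n) f i j)"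
    by (simp add: lazy_killed_def fun_eq_iff)
  also have "(lazy_killed p P ^^ t) \<dots> i j
    = (1 - p) * (lazy_killed p P ^^ t) ((killed P ^^ n) f) i j
      + p * (lazy_killed p P ^^ t) ((killed P ^^ Suc n) f) i j"
    by (simp only: lazy_killed_pow_lincomb)
  also have "\<dots> \<le> (1 - p) * (C * \<rho> ^ n * (1 - p + p * \<rho>) ^ t)
      + p * (C * \<rho> ^ Suc n * (1 - p + p * \<rho>) ^ t)"
    using assms by (intro add_mono mult_left_mono Suc.IH) auto
  also have "\<dots> = C * \<rho> ^ n * (1 - p + p * \<rho>) ^ Suc t"
    by (simp add: algebra_simps)
  finally show ?case .
qed

text \<open>Row sums 1 let the resting packet be split with the same weights as the moving one, so
  one pair of packets turns into a mixture of such pairs.\<close>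

lemma rlgl_step_axis_diff:
  assumes "stochastic_matrix P" "i \<noteq> j"
  shows "rlgl_step P u (axis i 1 - axis j 1) =
    (if u = i then (\<Sum>k\<in>UNIV. P $ i $ k *\<^sub>R (axis k 1 - axis j 1))
     else if u = j then (\<Sum>k\<in>UNIV. P $ j $ k *\<^sub>R (axis i 1 - axis k 1))
     else axis i 1 - axis j 1)"
proof -
  have row: "(\<Sum>k\<in>UNIV. P $ i $ k *\<^sub>R axis k 1) = P $ i" for i
    by (simp add: vec_eq_iff axis_def if_distrib[of "\<lambda>x. x * _"] if_distrib[of "\<lambda>x. _ * x"] cong: if_cong)
  have one: "(\<Sum>k\<in>UNIV. P $ i $ k) = 1" for i
    using assms by (simp add: stochastic_matrix_def)
  show ?thesis
    using assms(2)
    by (simp add: rlgl_step_def scaleR_diff_right sum_subtractf row scaleR_left.sum[symmetric] one)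
       (simp add: axis_def)
qed

text \<open>Each of \<open>i\<close> and \<open>j\<close> is lit with probability 1/N. Subadditivity
  bounds the resulting mixture by the mean over its pairs, and a pair on one place carries no cash,
  which is the annihilation.\<close>

lemma mean_norm1_axis_diff_Suc:
  fixes P :: "real^'n^'n::finite"
  assumes P: "stochastic_matrix P"
  shows "mean_norm1 P (Suc t) (axis i 1 - axis j 1)
    \<le> lazy_killed (2 / CARD('n)) P (\<lambda>i j. mean_norm1 P t (axis i 1 - axis j 1)) i j"
proof (cases "i = j")
  case True
  then show ?thesis by (simp add: lazy_killed_def killed_def rlgl_step_def)
next
  case False
  define D where "D = (\<lambda>i j. mean_norm1 P t (axis i 1 - axis j 1))"
  define A where "A = (\<Sum>k\<in>UNIV. P $ i $ k * D k j)"
  define B where "B = (\<Sum>k\<in>UNIV. P $ j $ k * D i k)"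
  have nn: "P $ i $ k \<ge> 0" for i k using P by (simp add: stochastic_matrix_def)
  have le: "mean_norm1 P t (rlgl_step P u (axis i 1 - axis j 1))
      \<le> (if u = i then A else if u = j then B else D i j)" for u
    unfolding rlgl_step_axis_diff[OF P False] A_def B_def D_def
    by (auto intro!: mean_norm1_sum_le nn)
  have "(\<Sum>u\<in>UNIV. mean_norm1 P t (rlgl_step P u (axis i 1 - axis j 1)))
    \<le> (\<Sum>u\<in>UNIV. if u = i then A else if u = j then B else D i j)"
    by (intro sum_mono le)
  also have "\<dots> = (\<Sum>u\<in>UNIV. (if u = i then A - D i j else 0) + (if u = j then B - D i j else 0) + D i j)"
    using False by (intro sum.cong) auto
  also have "\<dots> = A - D i j + (B - D i j) + CARD('n) * D i j"
    by (simp add: sum.distrib)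
  finally have "mean_norm1 P (Suc t) (axis i 1 - axis j 1)
    \<le> (A - D i j + (B - D i j) + CARD('n) * D i j) / CARD('n)"
    by (simp add: divide_right_mono)
  also have "\<dots> = lazy_killed (2 / CARD('n)) P D i j"
    using False by (simp add: lazy_killed_def killed_def A_def B_def field_simps)
  finally show ?thesis unfolding D_def .
qed

text \<open>The factor 2 bounds the norm of two unit packets of opposite sign. The bound on
  \<open>CARD('n)\<close> makes \<open>2 / CARD('n)\<close> a probability.\<close>

lemma mean_norm1_axis_diff:
  fixes P :: "real^'n^'n::finite"
  assumes P: "stochastic_matrix P" and N: "CARD('n) \<ge> 2"
  shows "mean_norm1 P t (axis i 1 - axis j 1)
    \<le> 2 * (lazy_killed (2 / CARD('n)) P ^^ t) apart i j"
proof (induction t arbitrary: i j)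
  case 0
  have "norm1 (axis i 1 - axis j 1 :: real^'n) \<le> norm1 (axis i 1 :: real^'n) + norm1 (axis j 1 :: real^'n)"
    unfolding norm1_def sum.distrib[symmetric] by (intro sum_mono) auto
  also have "\<dots> = 2"
    by (simp add: norm1_def axis_def if_distrib[of abs] cong: if_cong)
  finally show ?case by (simp add: apart_def norm1_def)
next
  case (Suc t)
  let ?D = "\<lambda>i j. mean_norm1 P t (axis i 1 - axis j 1)"
  let ?p = "2 / real CARD('n)"
  have "mean_norm1 P (Suc t) (axis i 1 - axis j 1) \<le> lazy_killed ?p P ?D i j"
    by (rule mean_norm1_axis_diff_Suc[OF P])
  \<comment> \<open>The zero term gives the function the two-term form of
    \<open>lazy_killed_lincomb\<close>.\<close>
  also have "\<dots> \<le> lazy_killed ?p P (\<lambda>i j. 2 * (lazy_killed ?p P ^^ t) apart i j + 0 * apart i j) i j"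
    using N Suc.IH by (intro lazy_killed_mono P) auto
  also have "\<dots> = 2 * (lazy_killed ?p P ^^ Suc t) apart i j"
    by (subst lazy_killed_lincomb) simp
  finally show ?case .
qed

text \<open>The vector is the cash at time 1: the mixture of the pairs
  \<open>axis k 1 - axis i 1\<close> with weights \<open>M0 $ i * P $ i $ k\<close>.\<close>

lemma mean_norm1_zero_sum_row:
  fixes P :: "real^'n^'n::finite"
  assumes P: "stochastic_matrix P" and M: "prob_vector M0"
    and le: "\<And>i j. mean_norm1 P t (axis i 1 - axis j 1) \<le> B"
  shows "mean_norm1 P t (- (M0 v* (mat 1 - P))) \<le> B"
proof -
  have nn: "P $ i $ k \<ge> 0" "M0 $ i \<ge> 0" for i k
    using P M by (auto simp: stochastic_matrix_def prob_vector_def)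
  have one: "(\<Sum>k\<in>UNIV. P $ i $ k) = 1" "(\<Sum>i\<in>UNIV. M0 $ i) = 1" for i
    using P M by (auto simp: stochastic_matrix_def prob_vector_def)
  have row: "(\<Sum>k\<in>UNIV. P $ i $ k *\<^sub>R (axis k 1 - axis i 1)) = P $ i - axis i 1" for i
    by (simp add: scaleR_diff_right sum_subtractf scaleR_left.sum[symmetric] one)
      (simp add: vec_eq_iff axis_def if_distrib[of "\<lambda>x. x * _"] if_distrib[of "\<lambda>x. _ * x"] cong: if_cong)
  have "- (M0 v* (mat 1 - P)) = (\<Sum>i\<in>UNIV. M0 $ i *\<^sub>R (P $ i - axis i 1))"
    by (simp add: vec_eq_iff vector_matrix_mult_def mat_def axis_def right_diff_distrib
        left_diff_distrib sum_subtractf sum_negf[symmetric] algebra_simps eq_commute cong: if_cong)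
  then have "mean_norm1 P t (- (M0 v* (mat 1 - P)))
    \<le> (\<Sum>i\<in>UNIV. M0 $ i * mean_norm1 P t (\<Sum>k\<in>UNIV. P $ i $ k *\<^sub>R (axis k 1 - axis i 1)))"
    unfolding row using mean_norm1_sum_le[OF nn(2)] by simp
  also have "\<dots> \<le> (\<Sum>i\<in>UNIV. M0 $ i * (\<Sum>k\<in>UNIV. P $ i $ k * B))"
    by (intro sum_mono mult_left_mono nn order_trans[OF mean_norm1_sum_le] le)
  also have "\<dots> = B"
    by (simp add: sum_distrib_right[symmetric] one)
  finally show ?thesis .
qed

section \<open>Survival of the walkers\<close>

lemma matrix_mult_nth: "(A ** B) $ i $ j = (\<Sum>k\<in>UNIV. A $ i $ k * B $ k $ j)"
  for A :: "real^'n::finite^'n"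
  by (simp add: matrix_matrix_mult_def)

lemma matpow_Suc_left: "matpow A (Suc n) = A ** matpow A n"
  by (induction n) (simp, metis matrix_mul_assoc matpow.simps(2))

lemma stochastic_matrix_matpow:
  assumes P: "stochastic_matrix P"
  shows "stochastic_matrix (matpow P n)"
proof (induction n)
  case 0
  then show ?case
    by (simp add: stochastic_matrix_def mat_def)
next
  case (Suc n)
  have "(\<Sum>j\<in>UNIV. \<Sum>k\<in>UNIV. matpow P n $ i $ k * P $ k $ j) = 1" for i
    using Suc P
    by (subst sum.swap) (simp add: stochastic_matrix_def sum_distrib_left[symmetric])
  with Suc P show ?case
    by (simp add: stochastic_matrix_def matrix_mult_nth sum_nonneg)
qed

text \<open>The entry at \<open>(i, j)\<close> of P^a (P^b)^T: the probability that independent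
  walkers sit at the same place after \<open>a\<close> and \<open>b\<close> jumps.\<close>

definition same_place :: "real^'n^'n \<Rightarrow> nat \<Rightarrow> nat \<Rightarrow> 'n::finite \<Rightarrow> 'n \<Rightarrow> real" where
  "same_place P a b i j = (\<Sum>k\<in>UNIV. matpow P a $ i $ k * matpow P b $ j $ k)"

text \<open>The pair without annihilation: the formula of \<open>killed\<close>, kept on the
  diagonal as well.\<close>

definition jump :: "real^'n^'n \<Rightarrow> ('n \<Rightarrow> 'n \<Rightarrow> real) \<Rightarrow> 'n::finite \<Rightarrow> 'n \<Rightarrow> real" where
  "jump P g i j = ((\<Sum>k\<in>UNIV. P $ i $ k * g k j) + (\<Sum>k\<in>UNIV. P $ j $ k * g i k)) / 2"

lemma same_place_Suc:
  "(\<Sum>k\<in>UNIV. P $ i $ k * same_place P a b k j) = same_place P (Suc a) b i j"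
  "(\<Sum>k\<in>UNIV. P $ j $ k * same_place P a b i k) = same_place P a (Suc b) i j"
proof -
  show "(\<Sum>k\<in>UNIV. P $ i $ k * same_place P a b k j) = same_place P (Suc a) b i j"
    unfolding same_place_def matpow_Suc_left matrix_mult_nth sum_distrib_left sum_distrib_right
    by (subst sum.swap) (simp add: algebra_simps)
  show "(\<Sum>k\<in>UNIV. P $ j $ k * same_place P a b i k) = same_place P a (Suc b) i j"
    unfolding same_place_def matpow_Suc_left matrix_mult_nth sum_distrib_left sum_distrib_right
    by (subst sum.swap) (simp add: algebra_simps)
qed

lemma jump_same_place:
  "jump P (same_place P a b) = (\<lambda>i j. (same_place P (Suc a) b i j + same_place P a (Suc b) i j) / 2)"
  by (simp add: jump_def fun_eq_iff same_place_Suc)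

lemma jump_average:
  "jump P (\<lambda>i j. (f i j + g i j) / 2) = (\<lambda>i j. (jump P f i j + jump P g i j) / 2)"
  by (simp add: jump_def fun_eq_iff sum.distrib distrib_left sum_divide_distrib[symmetric] field_simps)

lemma jump_pow_average:
  "(jump P ^^ n) (\<lambda>i j. (f i j + g i j) / 2) = (\<lambda>i j. ((jump P ^^ n) f i j + (jump P ^^ n) g i j) / 2)"
  by (induction n) (simp_all add: jump_average)

text \<open>Entries above \<open>\<eta>\<close> averaged against a probability row give at least
  \<open>\<eta>\<close>, so one long walk suffices.\<close>

lemma same_place_ge:
  assumes P: "stochastic_matrix P"
    and \<eta>: "\<And>r' i j. r' > r \<Longrightarrow> matpow P r' $ i $ j > \<eta>"
    and ab: "a > r \<or> b > r"
  shows "same_place P a b i j \<ge> \<eta>"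
proof -
  have st: "stochastic_matrix (matpow P n)" for n by (rule stochastic_matrix_matpow[OF P])
  have one: "(\<Sum>k\<in>UNIV. matpow P n $ i $ k * \<eta>) = \<eta>" "(\<Sum>k\<in>UNIV. \<eta> * matpow P n $ i $ k) = \<eta>" for n i
    using st[of n] by (simp_all add: stochastic_matrix_def sum_distrib_right[symmetric] sum_distrib_left[symmetric])
  have nn: "matpow P n $ i $ k \<ge> 0" for n i k
    using st[of n] by (simp add: stochastic_matrix_def)
  from ab show ?thesis
  proof
    assume "a > r"
    then have "(\<Sum>k\<in>UNIV. \<eta> * matpow P b $ j $ k) \<le> same_place P a b i j"
      unfolding same_place_def by (intro sum_mono mult_right_mono nn less_imp_le[OF \<eta>])
    then show ?thesis by (simp add: one)
  next
    assume "b > r"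
    then have "(\<Sum>k\<in>UNIV. matpow P a $ i $ k * \<eta>) \<le> same_place P a b i j"
      unfolding same_place_def by (intro sum_mono mult_left_mono nn less_imp_le[OF \<eta>])
    then show ?thesis by (simp add: one)
  qed
qed

text \<open>Pigeonhole: however the \<open>n\<close> jumps are shared out, the two totals add up to
  more than \<open>2 * r\<close>, so one of them exceeds \<open>r\<close>.\<close>

lemma jump_pow_same_place_ge:
  assumes P: "stochastic_matrix P"
    and \<eta>: "\<And>r' i j. r' > r \<Longrightarrow> matpow P r' $ i $ j > \<eta>"
    and "a + b + n > 2 * r"
  shows "(jump P ^^ n) (same_place P a b) i j \<ge> \<eta>"
  using assms(3)
proof (induction n arbitrary: a b)
  case 0
  then have "a > r \<or> b > r" by linarith
  then show ?case using same_place_ge[OF P \<eta>] by simp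
next
  case (Suc n)
  have "(jump P ^^ Suc n) (same_place P a b) i j
    = ((jump P ^^ n) (same_place P (Suc a) b) i j + (jump P ^^ n) (same_place P a (Suc b)) i j) / 2"
    by (simp only: funpow_Suc_right o_def jump_same_place jump_pow_average)
  then show ?case using Suc.IH[of "Suc a" b] Suc.IH[of a "Suc b"] Suc.prems by simp
qed

section \<open>Survival probabilities of the annihilating walkers\<close>

lemma apart_simps [simp]: "apart i i = 0" "i \<noteq> j \<Longrightarrow> apart i j = 1" "apart i j \<le> 1" "0 \<le> apart i j"
  by (auto simp: apart_def)

lemma killed_pow_apart_bounds:
  assumes P: "stochastic_matrix P"
  shows "0 \<le> (killed P ^^ n) apart i j \<and> (killed P ^^ n) apart i j \<le> apart i j"
proof (induction n arbitrary: i j)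
  case 0
  then show ?case by (simp add: apart_def)
next
  case (Suc n)
  have nn: "P $ i $ k \<ge> 0" for i k using P by (simp add: stochastic_matrix_def)
  have le: "P $ i $ k * (killed P ^^ n) apart a b \<le> P $ i $ k" for i k a b
  proof -
    have "(killed P ^^ n) apart a b \<le> 1"
      using Suc[of a b] apart_simps(3)[of a b] by linarith
    then show ?thesis by (rule mult_left_le[OF _ nn])
  qed
  have "(\<Sum>k\<in>UNIV. P $ i $ k * (killed P ^^ n) apart k j) \<le> (\<Sum>k\<in>UNIV. P $ i $ k)"
    "(\<Sum>k\<in>UNIV. P $ j $ k * (killed P ^^ n) apart i k) \<le> (\<Sum>k\<in>UNIV. P $ j $ k)"
    by (intro sum_mono le)+
  with P show ?case
    using Suc by (cases "i = j") (auto simp: killed_def[of P "(killed P ^^ n) apart"] stochastic_matrix_def intro!: add_nonneg_nonneg sum_nonneg)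
qed

text \<open>Walkers that coincide after \<open>n\<close> jumps have met by then, so survival
  excludes coincidence of the pair that keeps jumping.\<close>

lemma killed_pow_apart_le_jump:
  assumes P: "stochastic_matrix P"
  shows "(killed P ^^ n) apart i j \<le> 1 - (jump P ^^ n) (same_place P 0 0) i j"
proof -
  have nn: "P $ i $ k \<ge> 0" for i k using P by (simp add: stochastic_matrix_def)
  have one: "(\<Sum>k\<in>UNIV. P $ i $ k) = 1" for i using P by (simp add: stochastic_matrix_def)
  have "(jump P ^^ n) (same_place P 0 0) i j \<le> 1 - (killed P ^^ n) apart i j"
  proof (induction n arbitrary: i j)
    case 0
    have "same_place P 0 0 i j = 1 - apart i j"
      by (simp add: same_place_def apart_def mat_def if_distrib[of "\<lambda>x. x * _"] cong: if_cong)
    then show ?case by simp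
  next
    case (Suc n)
    let ?J = "(jump P ^^ n) (same_place P 0 0)" and ?K = "(killed P ^^ n) apart"
    have "(\<Sum>k\<in>UNIV. P $ i $ k * ?J k j) \<le> (\<Sum>k\<in>UNIV. P $ i $ k * (1 - ?K k j))"
      "(\<Sum>k\<in>UNIV. P $ j $ k * ?J i k) \<le> (\<Sum>k\<in>UNIV. P $ j $ k * (1 - ?K i k))"
      by (intro sum_mono mult_left_mono nn Suc)+
    moreover have "0 \<le> (\<Sum>k\<in>UNIV. P $ i $ k * ?K k j)" "0 \<le> (\<Sum>k\<in>UNIV. P $ j $ k * ?K i k)"
      by (intro sum_nonneg mult_nonneg_nonneg nn killed_pow_apart_bounds[OF P, THEN conjunct1])+
    ultimately show ?case
      by (auto simp: jump_def[of P ?J] killed_def[of P ?K] right_diff_distrib sum_subtractf one field_simps)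
  qed
  then show ?thesis by linarith
qed

lemma killed_pow_apart_block:
  assumes P: "stochastic_matrix P"
    and \<eta>: "\<And>r' i j. r' > r \<Longrightarrow> matpow P r' $ i $ j > \<eta>"
  shows "(killed P ^^ (2 * r + 1)) apart i j \<le> (1 - \<eta>) * apart i j"
proof (cases "i = j")
  case True
  then show ?thesis using killed_pow_apart_bounds[OF P, of "2 * r + 1" i j] by simp
next
  case False
  then show ?thesis
    using killed_pow_apart_le_jump[OF P, of "2 * r + 1" i j]
      jump_pow_same_place_ge[OF P \<eta>, of r 0 0 "2 * r + 1" i j] by simp
qed

text \<open>The terms of the diagonal of P in P P^T compensate for the pairs that already met at the
  first jump, so that no factor is lost for lazy chains.\<close>

lemma killed_apart_second_jump:
  assumes P: "stochastic_matrix P"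
    and \<eta>: "\<And>i j. matpow P 2 $ i $ j \<ge> \<eta>"
  shows "killed P (killed P apart) i j \<le> killed P apart i j - \<eta> / 2 * apart i j"
proof (cases "i = j")
  case True
  then show ?thesis by (simp add: killed_def)
next
  case False
  have nn: "P $ i $ k \<ge> 0" for i k using P by (simp add: stochastic_matrix_def)
  have one: "(\<Sum>k\<in>UNIV. P $ i $ k) = 1" for i using P by (simp add: stochastic_matrix_def)
  have first: "killed P apart a b = apart a b - (if a = b then 0 else (P $ a $ b + P $ b $ a) / 2)" for a b
  proof -
    have "(\<Sum>k\<in>UNIV. P $ i $ k * apart k j) = (\<Sum>k\<in>UNIV. P $ i $ k - (if k = j then P $ i $ j else 0))"
      "(\<Sum>k\<in>UNIV. P $ i $ k * apart j k) = (\<Sum>k\<in>UNIV. P $ i $ k - (if k = j then P $ i $ j else 0))" for i j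
      by (auto simp: apart_def intro!: sum.cong)
    moreover have "(\<Sum>k\<in>UNIV. P $ i $ k - (if k = j then P $ i $ j else 0)) = 1 - P $ i $ j" for i j
      by (simp add: sum_subtractf one)
    ultimately have row: "(\<Sum>k\<in>UNIV. P $ i $ k * apart k j) = 1 - P $ i $ j"
      "(\<Sum>k\<in>UNIV. P $ i $ k * apart j k) = 1 - P $ i $ j" for i j
      by auto
    show ?thesis
      unfolding killed_def row by (auto simp: field_simps)
  qed
  define S where "S = (\<Sum>k\<in>UNIV. P $ i $ k * P $ j $ k)"
  have sq: "(\<Sum>k\<in>UNIV. P $ i $ k * P $ k $ j) = matpow P 2 $ i $ j" for i j
    by (simp add: numeral_2_eq_2 matrix_mult_nth)
  \<comment> \<open>The formula for \<open>a \<noteq> b\<close> in \<open>first\<close> would give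
    \<open>- P $ j $ j\<close> at \<open>k = j\<close>, where the true value is 0; the last summand
    corrects this.\<close>
  have c1: "(\<Sum>k\<in>UNIV. P $ i $ k * killed P apart k j)
    = (\<Sum>k\<in>UNIV. P $ i $ k * apart k j) - (matpow P 2 $ i $ j + S) / 2 + P $ i $ j * P $ j $ j"
  proof -
    have "(\<Sum>k\<in>UNIV. P $ i $ k * killed P apart k j)
      = (\<Sum>k\<in>UNIV. P $ i $ k * apart k j - (P $ i $ k * P $ k $ j + P $ i $ k * P $ j $ k) / 2
          + (if k = j then P $ i $ j * P $ j $ j else 0))"
      by (intro sum.cong) (auto simp: first algebra_simps)
    then show ?thesis
      by (simp add: sum.distrib sum_subtractf sum_divide_distrib[symmetric] sq S_def)
  qed
  have c2: "(\<Sum>k\<in>UNIV. P $ j $ k * killed P apart i k)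
    = (\<Sum>k\<in>UNIV. P $ j $ k * apart i k) - (matpow P 2 $ j $ i + S) / 2 + P $ j $ i * P $ i $ i"
  proof -
    have "(\<Sum>k\<in>UNIV. P $ j $ k * killed P apart i k)
      = (\<Sum>k\<in>UNIV. P $ j $ k * apart i k - (P $ j $ k * P $ k $ i + P $ i $ k * P $ j $ k) / 2
          + (if k = i then P $ j $ i * P $ i $ i else 0))"
      by (intro sum.cong) (auto simp: first algebra_simps)
    then show ?thesis
      by (simp add: sum.distrib sum_subtractf sum_divide_distrib[symmetric] sq S_def)
  qed
  have "P $ i $ j * P $ j $ j + P $ j $ i * P $ i $ i = (\<Sum>k\<in>{i, j}. P $ i $ k * P $ j $ k)"
    using False by (simp add: mult.commute)
  also have "\<dots> \<le> S"
    unfolding S_def by (intro sum_mono2) (auto simp: nn)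
  finally have "P $ i $ j * P $ j $ j + P $ j $ i * P $ i $ i \<le> S" .
  moreover have "killed P (killed P apart) i j = killed P apart i j
    - (matpow P 2 $ i $ j + matpow P 2 $ j $ i + 2 * (S - P $ i $ j * P $ j $ j - P $ j $ i * P $ i $ i)) / 4"
    using False unfolding killed_def[of P "killed P apart"] c1 c2 by (simp add: killed_def field_simps)
  moreover have "b = a - (m + m' + 2 * (S - x - y)) / 4 \<Longrightarrow> x + y \<le> S \<Longrightarrow> \<eta> \<le> m \<Longrightarrow> \<eta> \<le> m'
    \<Longrightarrow> b \<le> a - \<eta> / 2" for a b m m' x y :: real
    by simp
  ultimately have "killed P (killed P apart) i j \<le> killed P apart i j - \<eta> / 2"
    using \<eta>[of i j] \<eta>[of j i] by blast
  then show ?thesis using False by simp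
qed

text \<open>Let h(n) be the survival after n jumps. Then h(2) \<le> h(1) - \<eta>/2 h(0) and h(3)
  \<le> h(2) - \<eta>/2 h(1); adding these and using h(1) \<le> h(0) gives the full factor 1 -
  \<eta> for two jumps.\<close>

lemma killed_pow_apart_two:
  assumes P: "stochastic_matrix P"
    and \<eta>: "\<And>i j. matpow P 2 $ i $ j \<ge> \<eta>" "\<eta> \<ge> 0"
  shows "(killed P ^^ 3) apart i j \<le> (1 - \<eta>) * killed P apart i j"
proof -
  let ?h = "\<lambda>n. (killed P ^^ n) apart"
  have step: "?h (n + 2) i j \<le> ?h (n + 1) i j - \<eta> / 2 * ?h n i j" for n
  proof -
    have "(killed P ^^ n) (killed P (killed P apart)) i j
      \<le> (killed P ^^ n) (\<lambda>i j. 1 * killed P apart i j + (- \<eta> / 2) * apart i j) i j"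
      by (intro killed_pow_mono[OF P]) (use killed_apart_second_jump[OF P \<eta>(1)] in simp)
    then show ?thesis
      unfolding killed_pow_lincomb by (simp add: funpow_swap1)
  qed
  have "?h 1 i j \<le> apart i j" using killed_pow_apart_bounds[OF P, of 1 i j] by simp
  then have "\<eta> / 2 * ?h 1 i j \<le> \<eta> / 2 * apart i j"
    using \<eta>(2) by (intro mult_left_mono) auto
  then show ?thesis
    using step[of 0] step[of 1] by (simp add: eval_nat_numeral algebra_simps)
qed

text \<open>Monotonicity lets the block estimate act under the remaining \<open>k\<close> jumps, so
  every full block of \<open>L\<close> jumps beyond \<open>m\<close> costs a factor
  \<open>\<sigma>\<close>.\<close>

lemma killed_pow_geometric:
  assumes P: "stochastic_matrix P" and L: "L > 0" and \<sigma>: "0 \<le> \<sigma>" "\<sigma> \<le> 1"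
    and block: "\<And>i j. (killed P ^^ (m + L)) apart i j \<le> \<sigma> * (killed P ^^ m) apart i j"
  shows "(killed P ^^ (m + n)) apart i j \<le> \<sigma> ^ (n div L)"
proof (induction n arbitrary: i j rule: less_induct)
  case (less n)
  show ?case
  proof (cases "n < L")
    case True
    then show ?thesis using killed_pow_apart_bounds[OF P, of "m + n" i j] apart_simps(3)[of i j] by (simp del: apart_simps)
  next
    case False
    then obtain k where k: "n = k + L" by (metis add.commute le_Suc_ex not_less)
    have "(killed P ^^ (m + n)) apart i j = (killed P ^^ k) ((killed P ^^ (m + L)) apart) i j"
      by (metis k add.assoc add.commute comp_apply funpow_add)
    also have "\<dots> \<le> (killed P ^^ k) (\<lambda>i j. \<sigma> * (killed P ^^ m) apart i j + 0 * apart i j) i j"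
      by (intro killed_pow_mono[OF P]) (use block in simp)
    also have "\<dots> = \<sigma> * (killed P ^^ k) ((killed P ^^ m) apart) i j"
      by (subst killed_pow_lincomb) simp
    also have "(killed P ^^ k) ((killed P ^^ m) apart) i j = (killed P ^^ (m + k)) apart i j"
      by (metis add.commute comp_apply funpow_add)
    also have "\<sigma> * \<dots> \<le> \<sigma> * \<sigma> ^ (k div L)"
      using less.IH[of k i j] k L \<sigma> by (intro mult_left_mono) auto
    finally show ?thesis using L by (simp add: k)
  qed
qed

text \<open>The incomplete last block has fewer than \<open>L\<close> jumps, hence the loss of
  \<open>1 / \<rho> ^ L\<close>.\<close>

lemma power_div_le:
  fixes \<rho> \<sigma> :: real
  assumes "0 < \<rho>" "\<rho> \<le> 1" "0 \<le> \<sigma>" "\<sigma> \<le> \<rho> ^ L" "L > 0"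
  shows "\<sigma> ^ (n div L) \<le> \<rho> ^ n / \<rho> ^ L"
proof -
  have "n \<le> L * (n div L) + L"
    using assms(5) by (metis add_left_mono mod_less_divisor less_imp_le mult_div_mod_eq)
  then have "\<rho> ^ (L * (n div L) + L) \<le> \<rho> ^ n"
    using assms by (intro power_decreasing) auto
  moreover have "\<sigma> ^ (n div L) \<le> (\<rho> ^ L) ^ (n div L)"
    using assms by (intro power_mono) auto
  ultimately have "\<sigma> ^ (n div L) * \<rho> ^ L \<le> \<rho> ^ n"
    using assms by (smt (verit) mult_right_mono power_add power_mult zero_le_power)
  then show ?thesis using assms by (simp add: field_simps)
qed

lemma killed_pow_apart_decay:
  assumes P: "stochastic_matrix P" and L: "L > 0" and \<rho>: "0 < \<rho>" "\<rho> \<le> 1" and \<sigma>: "0 \<le> \<sigma>" "\<sigma> \<le> \<rho> ^ L"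
    and block: "\<And>i j. (killed P ^^ (m + L)) apart i j \<le> \<sigma> * (killed P ^^ m) apart i j"
  shows "(killed P ^^ n) apart i j \<le> 1 / \<rho> ^ (m + L) * \<rho> ^ n"
proof (cases "n < m")
  case True
  have "(killed P ^^ n) apart i j \<le> 1"
    using killed_pow_apart_bounds[OF P, of n i j] apart_simps(3)[of i j] by (simp del: apart_simps)
  also have "\<rho> ^ (m + L) \<le> \<rho> ^ n"
    using True \<rho> by (intro power_decreasing) auto
  then have "1 \<le> 1 / \<rho> ^ (m + L) * \<rho> ^ n"
    using \<rho> by (simp add: field_simps)
  finally show ?thesis .
next
  case False
  then obtain k where k: "n = m + k" using le_Suc_ex not_less by blast
  have "\<sigma> \<le> 1" using \<sigma> \<rho> by (meson less_imp_le order_trans power_le_one)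
  then have "(killed P ^^ n) apart i j \<le> \<sigma> ^ (k div L)"
    unfolding k using killed_pow_geometric[OF P L \<sigma>(1) _ block] by blast
  also have "\<dots> \<le> \<rho> ^ k / \<rho> ^ L" by (rule power_div_le[OF \<rho> \<sigma> L])
  also have "\<dots> = 1 / \<rho> ^ (m + L) * \<rho> ^ n"
    using \<rho> by (simp add: k power_add)
  finally show ?thesis .
qed

text \<open>The factor per jump for which \<open>2 * r\<close> jumps cost
  \<open>1 - eta_tilde r \<eta>\<close>.\<close>

definition jump_rate :: "nat \<Rightarrow> real \<Rightarrow> real" where
  "jump_rate r \<eta> = (1 - eta_tilde r \<eta>) powr (1 / (2 * real r))"

lemma eta_tilde_bounds:
  assumes "0 < \<eta>" "\<eta> < 1"
  shows "0 < eta_tilde r \<eta>" "eta_tilde r \<eta> < 1"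
proof -
  show "0 < eta_tilde r \<eta>" using assms by (simp add: eta_tilde_def)
  have "(1 / 2 :: real) ^ (r - 1) * \<eta> \<le> 1 * \<eta>"
    using assms by (intro mult_right_mono power_le_one) auto
  then show "eta_tilde r \<eta> < 1" using assms unfolding eta_tilde_def by linarith
qed

lemma jump_rate_bounds:
  assumes "0 < \<eta>" "\<eta> < 1" "r \<ge> 1"
  shows "0 < jump_rate r \<eta>" "jump_rate r \<eta> < 1"
    and "jump_rate r \<eta> ^ (2 * r) = 1 - eta_tilde r \<eta>"
    and "ln (jump_rate r \<eta>) = ln (1 - eta_tilde r \<eta>) / (2 * real r)"
proof -
  note e = eta_tilde_bounds[OF assms(1,2), of r]
  show "0 < jump_rate r \<eta>" using e by (simp add: jump_rate_def)
  have "jump_rate r \<eta> < 1 powr (1 / (2 * real r))"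
    unfolding jump_rate_def using e assms by (intro powr_less_mono2) auto
  then show "jump_rate r \<eta> < 1" by simp
  have "jump_rate r \<eta> ^ (2 * r) = (1 - eta_tilde r \<eta>) powr ((1 / (2 * real r)) * real (2 * r))"
    unfolding jump_rate_def using e by (subst powr_powr[symmetric]) (simp flip: powr_realpow)
  then show "jump_rate r \<eta> ^ (2 * r) = 1 - eta_tilde r \<eta>"
    using e assms by simp
  show "ln (jump_rate r \<eta>) = ln (1 - eta_tilde r \<eta>) / (2 * real r)"
    using e by (simp add: jump_rate_def ln_powr)
qed

lemma killed_pow_apart_jump_rate:
  assumes P: "stochastic_matrix P" and \<eta>: "0 < \<eta>" "\<eta> < 1" and r: "r \<ge> 1"
    and pos: "\<And>r' i j. r' > r \<Longrightarrow> matpow P r' $ i $ j > \<eta>"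
  shows "\<exists>C>0. \<forall>n i j. (killed P ^^ n) apart i j \<le> C * jump_rate r \<eta> ^ n"
proof -
  define \<rho> where "\<rho> = jump_rate r \<eta>"
  note \<rho> = jump_rate_bounds[OF \<eta> r, folded \<rho>_def]
  have "\<exists>m L. L > 0 \<and> 1 - \<eta> \<le> \<rho> ^ L \<and>
      (\<forall>i j. (killed P ^^ (m + L)) apart i j \<le> (1 - \<eta>) * (killed P ^^ m) apart i j)"
  proof (cases "r = 1")
    case True
    \<comment> \<open>Here \<open>eta_tilde\<close> equals \<open>\<eta>\<close>, which leaves no
      slack for a third jump in the block; the second-jump estimate gives a block of exactly two
      jumps, with offset one.\<close>
    have "\<And>i j. matpow P 2 $ i $ j \<ge> \<eta>" using pos[of 2] True by (simp add: less_imp_le)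
    then have "(killed P ^^ (1 + 2)) apart i j \<le> (1 - \<eta>) * (killed P ^^ 1) apart i j" for i j
      using killed_pow_apart_two[OF P, of \<eta> i j] \<eta> by (simp add: eval_nat_numeral)
    moreover have "1 - \<eta> \<le> \<rho> ^ 2"
      using \<rho>(3) True by (simp add: eta_tilde_def)
    ultimately show ?thesis by (intro exI[of _ 1] exI[of _ 2]) auto
  next
    case False
    \<comment> \<open>For \<open>r \<ge> 2\<close> only \<open>\<eta> / 2\<close> has to be gained
      in \<open>2 * r\<close> jumps, and (1 - \<eta>/2)^2 \<ge> 1 - \<eta> leaves room for one extra
      jump in the block.\<close>
    have "(1 / 2 :: real) ^ (r - 1) \<le> (1 / 2) ^ 1"
      using False r by (intro power_decreasing) auto
    then have e: "eta_tilde r \<eta> \<le> \<eta> / 2"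
      using mult_right_mono[of "(1 / 2 :: real) ^ (r - 1)" "1 / 2" \<eta>] \<eta> by (simp add: eta_tilde_def)
    then have s: "1 - \<eta> / 2 \<le> \<rho> ^ (2 * r)" using \<rho>(3) by simp
    also have "\<dots> \<le> \<rho> ^ 1" using \<rho> r by (intro power_decreasing) auto
    finally have "1 - \<eta> / 2 \<le> \<rho>" by simp
    with s have "(1 - \<eta> / 2) * (1 - \<eta> / 2) \<le> \<rho> ^ (2 * r) * \<rho>"
      using \<eta> \<rho> by (intro mult_mono) auto
    moreover have "1 - \<eta> \<le> (1 - \<eta> / 2) * (1 - \<eta> / 2)"
      by (simp add: algebra_simps)
    ultimately have "1 - \<eta> \<le> \<rho> ^ (2 * r + 1)" by (simp add: mult.commute)
    then show ?thesis
      using killed_pow_apart_block[OF P pos] by (intro exI[of _ 0] exI[of _ "2 * r + 1"]) auto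
  qed
  then obtain m L where mL: "L > 0" "1 - \<eta> \<le> \<rho> ^ L"
    "\<And>i j. (killed P ^^ (m + L)) apart i j \<le> (1 - \<eta>) * (killed P ^^ m) apart i j"
    by blast
  have "(killed P ^^ n) apart i j \<le> 1 / \<rho> ^ (m + L) * \<rho> ^ n" for n i j
    using \<rho> \<eta> mL by (intro killed_pow_apart_decay[OF P]) auto
  then show ?thesis using \<rho>(1) unfolding \<rho>_def[symmetric]
    by (intro exI[of _ "1 / \<rho> ^ (m + L)"]) auto
qed

section \<open>The rate as a relative entropy bound\<close>

text \<open>The Kullback-Leibler divergence of Bernoulli(\<open>x\<close>) from
  Bernoulli(\<open>p\<close>).\<close>

definition bernoulli_entropy :: "real \<Rightarrow> real \<Rightarrow> real" where
  "bernoulli_entropy x p = x * ln (x / p) + (1 - x) * ln ((1 - x) / (1 - p))"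

text \<open>From ln u \<le> u - 1 at \<open>p / x\<close> and \<open>(1 - p) / (1 - x)\<close>; the
  two resulting bounds cancel.\<close>

lemma bernoulli_entropy_nonneg:
  assumes "0 < x" "x < 1" "0 < p" "p < 1"
  shows "bernoulli_entropy x p \<ge> 0"
proof -
  have "x * ln (p / x) \<le> x * (p / x - 1)" "(1 - x) * ln ((1 - p) / (1 - x)) \<le> (1 - x) * ((1 - p) / (1 - x) - 1)"
    using assms by (intro mult_left_mono ln_le_minus_one; simp)+
  moreover have "x * (p / x - 1) = p - x" "(1 - x) * ((1 - p) / (1 - x) - 1) = x - p"
    using assms by (simp_all add: field_simps)
  moreover have "bernoulli_entropy x p = - (x * ln (p / x)) - (1 - x) * ln ((1 - p) / (1 - x))"
    using assms by (simp add: bernoulli_entropy_def ln_div algebra_simps)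
  ultimately show ?thesis by linarith
qed

text \<open>The three-point identity for relative entropy, in which every term is nonnegative for
  \<open>y \<le> x \<le> p\<close>.\<close>

lemma bernoulli_entropy_antimono:
  assumes "0 < y" "y \<le> x" "x \<le> p" "p < 1"
  shows "bernoulli_entropy x p \<le> bernoulli_entropy y p"
proof -
  have "bernoulli_entropy y p - bernoulli_entropy x p
    = bernoulli_entropy y x + (x - y) * (ln (p / x) + ln ((1 - x) / (1 - p)))"
    using assms by (simp add: bernoulli_entropy_def ln_div algebra_simps)
  moreover have "0 \<le> ln (p / x)" "0 \<le> ln ((1 - x) / (1 - p))"
    using assms by (auto intro!: ln_ge_zero)
  moreover have "0 \<le> bernoulli_entropy y x"
    using assms by (intro bernoulli_entropy_nonneg) auto
  ultimately show ?thesis using assms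
    by (smt (verit) mult_nonneg_nonneg)
qed

text \<open>The minimiser over y of the entropy at y plus y |ln \<rho>| is y = p \<rho> / q, with value - ln q.
  To its left x |ln \<rho>| is smaller than that value, to its right the entropy is.\<close>

lemma min_le_neg_ln_mgf:
  fixes x p \<rho> :: real
  assumes "0 < x" "x < p" "p < 1" "0 < \<rho>" "\<rho> < 1"
  shows "min (x * - ln \<rho>) (bernoulli_entropy x p) \<le> - ln (1 - p + p * \<rho>)"
proof -
  define q y where "q = 1 - p + p * \<rho>" and "y = p * \<rho> / q"
  have q: "0 < q" "p * \<rho> < q" using assms by (auto simp: q_def add_pos_pos)
  \<comment> \<open>\<open>q\<close> is a convex combination of 1 and \<open>\<rho>\<close>, hence
    exceeds \<open>\<rho>\<close>; this gives \<open>y \<le> p\<close>.\<close>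
  have "q - \<rho> = (1 - p) * (1 - \<rho>)" by (simp add: q_def algebra_simps)
  then have "q > \<rho>" using assms by (smt (verit) mult_pos_pos)
  then have "p * \<rho> \<le> p * q" using assms by (intro mult_left_mono) auto
  then have y: "0 < y" "y < 1" "y \<le> p"
    using assms q by (auto simp: y_def pos_divide_le_eq)
  \<comment> \<open>\<open>y\<close> is the success probability of Bernoulli(\<open>p\<close>) after
    success is given the weight \<open>\<rho>\<close>, so both likelihood ratios have denominator
    \<open>q\<close>.\<close>
  have "y / p = \<rho> / q" using assms q by (simp add: y_def)
  moreover have "1 - y = (1 - p) / q"
    using q by (simp add: y_def q_def diff_divide_distrib[symmetric] divide_eq_eq eq_divide_eq left_diff_distrib)
  then have "(1 - y) / (1 - p) = 1 / q" using assms by simp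
  ultimately have "bernoulli_entropy y p = y * ln (\<rho> / q) + (1 - y) * ln (1 / q)"
    by (simp add: bernoulli_entropy_def)
  also have "\<dots> = - ln q - y * - ln \<rho>"
    using assms q by (simp add: ln_div algebra_simps)
  finally have eq: "bernoulli_entropy y p = - ln q - y * - ln \<rho>" .
  show ?thesis
  proof (cases "x \<le> y")
    case True
    then have "x * - ln \<rho> \<le> y * - ln \<rho>" using assms by (intro mult_right_mono) auto
    then show ?thesis using eq bernoulli_entropy_nonneg[of y p] y assms
      unfolding q_def[symmetric] by linarith
  next
    case False
    have "0 \<le> y * - ln \<rho>" using y assms by (intro mult_nonneg_nonneg) auto
    then show ?thesis using eq bernoulli_entropy_antimono[of y x p] False y assms
      unfolding q_def[symmetric] by linarith
  qed
qed

text \<open>With x = 2 r \<beta> and p = 2 / N the range of \<beta> becomes 0 < x < p, and the two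
  terms under the minimum become x |ln \<rho>| and the relative entropy of x and p.\<close>

lemma rate_le:
  assumes N: "N > 2" and \<eta>: "0 < \<eta>" "\<eta> < 1" and r: "r \<ge> 1"
  shows "rate N r \<eta> \<le> - ln (1 - 2 / real N + 2 / real N * jump_rate r \<eta>)"
  unfolding rate_def
proof (rule cSUP_least)
  show "{0<..<1 / (real N * real r)} \<noteq> {}" using N r by (simp add: not_le)
next
  fix \<beta> assume \<beta>: "\<beta> \<in> {0<..<1 / (real N * real r)}"
  define x p where "x = 2 * real r * \<beta>" and "p = 2 / real N"
  note \<rho> = jump_rate_bounds[OF \<eta> r]
  have x: "0 < x" "x < p" "p < 1"
    using \<beta> N r by (auto simp: x_def p_def field_simps)
  have "ln (1 - eta_tilde r \<eta>) \<le> 0"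
    using eta_tilde_bounds[OF \<eta>, of r] by simp
  then have 1: "\<beta> * \<bar>ln (1 - eta_tilde r \<eta>)\<bar> = x * - ln (jump_rate r \<eta>)"
    using r by (simp add: \<rho>(4) x_def)
  have "real N * real r * \<beta> = x / p" "real N * (1 - 2 * real r * \<beta>) / (real N - 2) = (1 - x) / (1 - p)"
    using N by (simp_all add: x_def p_def field_simps)
  moreover have "1 - 2 * real r * \<beta> = 1 - x" by (simp add: x_def)
  ultimately have 2: "\<beta> * rate_J N r \<beta> = bernoulli_entropy x p"
    using \<beta> unfolding rate_J_def bernoulli_entropy_def by (simp add: algebra_simps x_def)
  show "min (\<beta> * \<bar>ln (1 - eta_tilde r \<eta>)\<bar>) (\<beta> * rate_J N r \<beta>)
      \<le> - ln (1 - 2 / real N + 2 / real N * jump_rate r \<eta>)"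
    unfolding 1 2 using min_le_neg_ln_mgf[OF x \<rho>(1,2)] by (simp add: p_def)
qed

text \<open>Each pair of packets contributes at most \<open>2 * C * q ^ t\<close>, and
  \<open>ln q\<close> is at most minus the rate.\<close>

lemma mean_norm1_decay:
  fixes P :: "real^'n^'n::finite"
  assumes N: "CARD('n) > 2" and P: "stochastic_matrix P" and M: "prob_vector M0"
    and \<eta>: "0 < \<eta>" "\<eta> < 1" and r: "r \<ge> 1"
    and pos: "\<And>r' i j. r' > r \<Longrightarrow> matpow P r' $ i $ j > \<eta>"
  shows "\<exists>B>0. \<forall>t. mean_norm1 P t (- (M0 v* (mat 1 - P))) \<le> B * exp (- rate CARD('n) r \<eta> * real t)"
proof -
  obtain C where C: "C > 0" "\<And>n i j. (killed P ^^ n) apart i j \<le> C * jump_rate r \<eta> ^ n"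
    using killed_pow_apart_jump_rate[OF P \<eta> r pos] by blast
  define q where "q = 1 - 2 / real CARD('n) + 2 / real CARD('n) * jump_rate r \<eta>"
  have q: "0 < q"
    unfolding q_def using N jump_rate_bounds[OF \<eta> r] by (intro add_pos_pos) auto
  have "mean_norm1 P t (- (M0 v* (mat 1 - P))) \<le> 2 * C * exp (- rate CARD('n) r \<eta> * real t)" for t
  proof (rule mean_norm1_zero_sum_row[OF P M])
    fix i j :: 'n
    have "mean_norm1 P t (axis i 1 - axis j 1) \<le> 2 * (lazy_killed (2 / CARD('n)) P ^^ t) apart i j"
      using N by (intro mean_norm1_axis_diff P) auto
    also have "(lazy_killed (2 / CARD('n)) P ^^ t) apart i j \<le> C * q ^ t"
      using lazy_killed_pow_le[OF _ _ C(2), of "2 / CARD('n)" t 0 i j] N by (simp add: q_def)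
    also have "q ^ t = exp (ln q * real t)"
      using q by (simp add: exp_of_nat2_mult)
    also have "\<dots> \<le> exp (- rate CARD('n) r \<eta> * real t)"
      using mult_right_mono[OF rate_le[OF N \<eta> r], of "real t"] by (simp add: q_def)
    finally show "mean_norm1 P t (axis i 1 - axis j 1) \<le> 2 * C * exp (- rate CARD('n) r \<eta> * real t)"
      using C(1) by simp
  qed
  then show ?thesis using C(1) by (intro exI[of _ "2 * C"]) auto
qed

section \<open>Expectation over the green lights\<close>

lemma borel_measurable_rlgl_step [measurable]: "rlgl_step P u \<in> borel_measurable borel"
  unfolding rlgl_step_def by (intro borel_measurable_continuous_onI continuous_intros)

lemma borel_measurable_norm1 [measurable]: "norm1 \<in> borel_measurable borel"
  unfolding norm1_def by (intro borel_measurable_continuous_onI continuous_intros)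

lemma borel_measurable_entry_sum [measurable]: "entry_sum \<in> borel_measurable borel"
  unfolding entry_sum_def by (intro borel_measurable_continuous_onI continuous_intros)

lemma borel_measurable_mean_norm1 [measurable]: "mean_norm1 P t \<in> borel_measurable borel"
proof (induction t)
  case 0
  then show ?case by (simp cong: measurable_cong)
next
  case (Suc t)
  note [measurable] = Suc
  have "(\<lambda>v. (\<Sum>u\<in>UNIV. mean_norm1 P t (rlgl_step P u v)) / CARD('a)) \<in> borel_measurable borel"
    by measurable
  then show ?case by (simp cong: measurable_cong)
qed

lemma rlgl_C_one: "rlgl_C P M0 G (Suc 0) = - (M0 v* (mat 1 - P))"
  by simp

text \<open>What makes the cash at time \<open>t\<close> independent of the light
  \<open>U t\<close>: this light enters only at the next step.\<close>

lemma rlgl_C_cong: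
  assumes "\<And>s. 1 \<le> s \<Longrightarrow> s < t \<Longrightarrow> U s \<omega> = V s \<omega>'"
  shows "rlgl_C P M0 (single_green U \<omega>) t = rlgl_C P M0 (single_green V \<omega>') t"
  using assms
proof (induction t)
  case (Suc t)
  show ?case
  proof (cases "t = 0")
    case False
    then show ?thesis using Suc by (simp add: rlgl_C_Suc_single_green del: rlgl_C.simps)
  qed (simp add: rlgl_C_one)
qed simp

lemma borel_measurable_rlgl_C:
  assumes "\<And>s. 1 \<le> s \<Longrightarrow> s < t \<Longrightarrow> U s \<in> M \<rightarrow>\<^sub>M count_space UNIV"
  shows "(\<lambda>\<omega>. rlgl_C P M0 (single_green U \<omega>) t) \<in> borel_measurable M"
  using assms
proof (induction t)
  case (Suc t)
  show ?case
  proof (cases "t = 0")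
    case True
    then show ?thesis by (simp add: rlgl_C_one)
  next
    case False
    then have [measurable]: "(\<lambda>\<omega>. rlgl_C P M0 (single_green U \<omega>) t) \<in> borel_measurable M"
      "U t \<in> M \<rightarrow>\<^sub>M count_space UNIV"
      using Suc by auto
    have "(\<lambda>\<omega>. rlgl_step P (U t \<omega>) (rlgl_C P M0 (single_green U \<omega>) t)) \<in> borel_measurable M"
      by (rule measurable_compose_countable[where g = "U t"]) measurable
    then show ?thesis using False by (simp only: rlgl_C_Suc_single_green)
  qed
qed simp

text \<open>Only finitely many light histories exist. Real functions of the cash are therefore
  bounded, and integrable once measurable.\<close>

lemma finite_range_rlgl_C: "finite (range (\<lambda>\<omega>. rlgl_C P M0 (single_green U \<omega>) t))"
proof (induction t)
  case (Suc t)
  show ?case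
  proof (cases "t = 0")
    case False
    then have "range (\<lambda>\<omega>. rlgl_C P M0 (single_green U \<omega>) (Suc t))
      \<subseteq> (\<Union>u. rlgl_step P u ` range (\<lambda>\<omega>. rlgl_C P M0 (single_green U \<omega>) t))"
      by (auto simp only: rlgl_C_Suc_single_green)
    then show ?thesis by (rule finite_subset) (use Suc in auto)
  qed (simp add: rlgl_C_one)
qed simp

lemma borel_measurable_rlgl_M:
  fixes P :: "real^'n^'n::finite"
  assumes "\<And>s. 1 \<le> s \<Longrightarrow> s \<le> t \<Longrightarrow> U s \<in> M \<rightarrow>\<^sub>M count_space UNIV"
  shows "(\<lambda>\<omega>. rlgl_M P M0 (single_green U \<omega>) t) \<in> borel_measurable M"
proof (cases "t = 0")
  case False
  then have [measurable]: "(\<lambda>\<omega>. rlgl_C P M0 (single_green U \<omega>) t) \<in> borel_measurable M"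
    "U t \<in> M \<rightarrow>\<^sub>M count_space UNIV"
    using assms by (auto intro!: borel_measurable_rlgl_C)
  have [measurable]: "(\<lambda>v. v $ u *\<^sub>R axis u 1 :: real^'n) \<in> borel_measurable borel" for u
    by (intro borel_measurable_continuous_onI continuous_intros)
  have "(\<lambda>\<omega>. (\<lambda>u v. v $ u *\<^sub>R axis u 1 :: real^'n) (U t \<omega>) (rlgl_C P M0 (single_green U \<omega>) t)) \<in> borel_measurable M"
    by (rule measurable_compose_countable[where g = "U t"]) measurable
  then show ?thesis using False by (simp add: rlgl_M_single_green)
qed simp

lemma borel_measurable_rlgl_H:
  assumes "\<And>s. 1 \<le> s \<Longrightarrow> s < t \<Longrightarrow> U s \<in> M \<rightarrow>\<^sub>M count_space UNIV"
  shows "(\<lambda>\<omega>. rlgl_H P M0 (single_green U \<omega>) t) \<in> borel_measurable M"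
  using assms
proof (induction t)
  case (Suc t)
  then have [measurable]: "(\<lambda>\<omega>. rlgl_H P M0 (single_green U \<omega>) t) \<in> borel_measurable M"
    "(\<lambda>\<omega>. rlgl_M P M0 (single_green U \<omega>) t) \<in> borel_measurable M"
    by (auto intro!: borel_measurable_rlgl_M)
  show ?case by simp
qed simp

section \<open>Expectations over independent uniform green lights\<close>

context prob_space
begin

lemma integrable_rlgl_C:
  fixes \<phi> :: "real^'n::finite \<Rightarrow> real"
  assumes [measurable]: "\<phi> \<in> borel_measurable borel" and "\<And>s. 1 \<le> s \<Longrightarrow> U s \<in> M \<rightarrow>\<^sub>M count_space UNIV"
  shows "integrable M (\<lambda>\<omega>. \<phi> (rlgl_C P M0 (single_green U \<omega>) t))"
proof -
  have [measurable]: "(\<lambda>\<omega>. rlgl_C P M0 (single_green U \<omega>) t) \<in> borel_measurable M"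
    using assms by (intro borel_measurable_rlgl_C) auto
  have "finite ((\<lambda>v. \<bar>\<phi> v\<bar>) ` range (\<lambda>\<omega>. rlgl_C P M0 (single_green U \<omega>) t))"
    by (intro finite_imageI finite_range_rlgl_C)
  then obtain B where "\<And>\<omega>. \<bar>\<phi> (rlgl_C P M0 (single_green U \<omega>) t)\<bar> \<le> B"
    using bdd_above_finite unfolding bdd_above_def by (metis image_eqI rangeI)
  then show ?thesis by (intro integrable_const_bound[of _ B]) auto
qed

text \<open>One-step Markov property: split by the value of the current light, which is independent
  of the cash and takes each value with probability 1/N.\<close>

lemma expectation_rlgl_step:
  fixes \<phi> :: "real^'n::finite \<Rightarrow> real"
  assumes ind: "indep_vars (\<lambda>_. count_space UNIV) U {1..}"
    and unif: "\<And>t. t \<ge> 1 \<Longrightarrow> distr M (count_space UNIV) (U t) = uniform_count_measure UNIV"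
    and [measurable]: "\<phi> \<in> borel_measurable borel" and t: "t \<ge> 1"
  shows "expectation (\<lambda>\<omega>. \<phi> (rlgl_C P M0 (single_green U \<omega>) (Suc t)))
    = expectation (\<lambda>\<omega>. (\<Sum>u\<in>UNIV. \<phi> (rlgl_step P u (rlgl_C P M0 (single_green U \<omega>) t))) / CARD('n))"
proof -
  let ?cs = "count_space UNIV :: 'n measure"
  let ?C = "\<lambda>\<omega>. rlgl_C P M0 (single_green U \<omega>) t"
  have U: "U s \<in> M \<rightarrow>\<^sub>M ?cs" if "s \<ge> 1" for s
    using ind that by (auto simp: indep_vars_def)
  note [measurable] = U[OF t]
  define X where "X = (\<lambda>u \<omega>. \<phi> (rlgl_step P u (?C \<omega>)))"
  define Y where "Y = (\<lambda>u \<omega>. indicator {u} (U t \<omega>) :: real)"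
  have X: "integrable M (X u)" for u
    unfolding X_def using integrable_rlgl_C[of "\<lambda>v. \<phi> (rlgl_step P u v)" U P M0 t] U by simp
  have Y: "integrable M (Y u)" for u
    unfolding Y_def by (intro integrable_const_bound[of _ 1]) auto
  have EY: "expectation (Y u) = 1 / CARD('n)" for u
  proof -
    have "expectation (Y u) = expectation (indicator (U t -` {u} \<inter> space M))"
      unfolding Y_def by (intro Bochner_Integration.integral_cong) (auto simp: indicator_def)
    also have "\<dots> = measure (distr M ?cs (U t)) {u}"
      by (subst measure_distr) auto
    also have "\<dots> = 1 / CARD('n)"
      by (simp add: unif[OF t] measure_uniform_count_measure)
    finally show ?thesis .
  qed
  have indXY: "indep_var borel (X u) borel (Y u)" for u
  proof -
    have [measurable]: "(\<lambda>x. rlgl_C P M0 (single_green (\<lambda>s x. x s) x) t)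
        \<in> borel_measurable (PiM {1..<t} (\<lambda>_. ?cs))"
      by (intro borel_measurable_rlgl_C) auto
    have [measurable]: "(\<lambda>x. \<phi> (rlgl_step P u (rlgl_C P M0 (single_green (\<lambda>s x. x s) x) t)))
        \<in> borel_measurable (PiM {1..<t} (\<lambda>_. ?cs))"
      by measurable
    have [measurable]: "(\<lambda>x. indicator {u} (x t) :: real) \<in> borel_measurable (PiM {t} (\<lambda>_. ?cs))"
      by measurable
    \<comment> \<open>The two factors are functions of disjoint blocks of lights: the times before
      \<open>t\<close>, and \<open>t\<close> alone.\<close>
    have "indep_var borel
        ((\<lambda>x. \<phi> (rlgl_step P u (rlgl_C P M0 (single_green (\<lambda>s x. x s) x) t))) \<circ> (\<lambda>\<omega>. restrict (\<lambda>s. U s \<omega>) {1..<t}))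
        borel ((\<lambda>x. indicator {u} (x t)) \<circ> (\<lambda>\<omega>. restrict (\<lambda>s. U s \<omega>) {t}))"
      using t by (intro indep_var_compose[OF indep_var_restrict[OF ind]]) (auto simp del: One_nat_def)
    also have "(\<lambda>x. \<phi> (rlgl_step P u (rlgl_C P M0 (single_green (\<lambda>s x. x s) x) t))) \<circ> (\<lambda>\<omega>. restrict (\<lambda>s. U s \<omega>) {1..<t}) = X u"
      unfolding X_def o_def
      by (intro ext arg_cong[of _ _ \<phi>] arg_cong[of _ _ "rlgl_step P u"] rlgl_C_cong) auto
    also have "(\<lambda>x. indicator {u} (x t)) \<circ> (\<lambda>\<omega>. restrict (\<lambda>s. U s \<omega>) {t}) = Y u"
      by (simp add: Y_def o_def)
    finally show ?thesis .
  qed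
  have "\<phi> (rlgl_C P M0 (single_green U \<omega>) (Suc t)) = (\<Sum>u\<in>UNIV. X u \<omega> * Y u \<omega>)" for \<omega>
    unfolding rlgl_C_Suc_single_green[OF t] X_def Y_def
    by (subst sum.cong[OF refl, of _ _ "\<lambda>u. if u = U t \<omega> then \<phi> (rlgl_step P u (?C \<omega>)) else 0"])
      (auto simp: indicator_def)
  then have "expectation (\<lambda>\<omega>. \<phi> (rlgl_C P M0 (single_green U \<omega>) (Suc t)))
    = (\<Sum>u\<in>UNIV. expectation (X u) * expectation (Y u))"
    using indep_var_integrable[OF indXY X Y] by (simp add: indep_var_lebesgue_integral[OF indXY X Y])
  also have "\<dots> = expectation (\<lambda>\<omega>. (\<Sum>u\<in>UNIV. X u \<omega>) / CARD('n))"
    using X by (simp add: EY sum_divide_distrib)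
  finally show ?thesis by (simp add: X_def)
qed

text \<open>Each induction step trades one random light for one level of the recursion. The index is
  shifted by one because the cash at time 1 is still deterministic.\<close>

lemma expectation_mean_norm1:
  fixes P :: "real^'n^'n::finite"
  assumes ind: "indep_vars (\<lambda>_. count_space UNIV) U {1..}"
    and unif: "\<And>t. t \<ge> 1 \<Longrightarrow> distr M (count_space UNIV) (U t) = uniform_count_measure UNIV"
  shows "expectation (\<lambda>\<omega>. mean_norm1 P s (rlgl_C P M0 (single_green U \<omega>) (Suc t)))
    = mean_norm1 P (s + t) (- (M0 v* (mat 1 - P)))"
proof (induction t arbitrary: s)
  case 0
  then show ?case by (simp only: rlgl_C_one) (simp add: prob_space)
next
  case (Suc t)
  have "expectation (\<lambda>\<omega>. mean_norm1 P s (rlgl_C P M0 (single_green U \<omega>) (Suc (Suc t))))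
    = expectation (\<lambda>\<omega>. mean_norm1 P (Suc s) (rlgl_C P M0 (single_green U \<omega>) (Suc t)))"
    by (subst expectation_rlgl_step[OF ind unif]) auto
  then show ?case by (simp only: Suc) simp
qed

end

section \<open>The error of the estimate\<close>

lemma norm1_nonneg: "0 \<le> norm1 v"
  by (simp add: norm1_def sum_nonneg)

lemma norm1_add_le: "norm1 (v + w) \<le> norm1 v + norm1 w"
  using mean_norm1_add_le[of _ 0 v w] by simp

lemma norm1_scaleR: "norm1 (c *\<^sub>R v) = \<bar>c\<bar> * norm1 v"
  by (simp add: norm1_def abs_mult sum_distrib_left)

text \<open>Subtracting \<eta> from every entry of A does not change the image of a zero-sum vector
  (Doeblin's minorisation).\<close>

lemma norm1_vector_matrix_mult_le:
  fixes A :: "real^'n^'n::finite"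
  assumes A: "stochastic_matrix A" and le: "\<And>i j. \<eta> \<le> A $ i $ j" and \<eta>: "0 \<le> \<eta>"
    and v: "\<eta> = 0 \<or> entry_sum v = 0"
  shows "norm1 (v v* A) \<le> (1 - \<eta>) * norm1 v"
proof -
  \<comment> \<open>The case \<open>\<eta> = 0\<close> yields that a stochastic matrix does not
    expand any vector; it is applied to \<open>P\<close> itself in
    \<open>norm1_diff_matpow_le\<close>.\<close>
  have "(\<Sum>i\<in>UNIV. v $ i * \<eta>) = 0"
    using v by (auto simp: entry_sum_def sum_distrib_right[symmetric])
  then have "(v v* A) $ j = (\<Sum>i\<in>UNIV. v $ i * (A $ i $ j - \<eta>))" for j
    by (simp add: vector_matrix_mult_def right_diff_distrib sum_subtractf mult.commute)
  then have "norm1 (v v* A) \<le> (\<Sum>j\<in>UNIV. \<Sum>i\<in>UNIV. \<bar>v $ i\<bar> * (A $ i $ j - \<eta>))"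
    unfolding norm1_def
    by (auto intro!: sum_mono order_trans[OF sum_abs] simp: abs_mult le)
  also have "\<dots> = (\<Sum>i\<in>UNIV. \<bar>v $ i\<bar> * (1 - CARD('n) * \<eta>))"
    using A by (subst sum.swap) (simp add: sum_distrib_left[symmetric] sum_subtractf stochastic_matrix_def)
  also have "\<dots> = (1 - CARD('n) * \<eta>) * norm1 v"
    by (simp add: norm1_def sum_distrib_left mult.commute)
  also have "\<dots> \<le> (1 - \<eta>) * norm1 v"
    using \<eta> mult_right_mono[of 1 "real CARD('n)" \<eta>]
    by (intro mult_right_mono norm1_nonneg) (simp_all add: Suc_leI)
  finally show ?thesis .
qed

text \<open>Telescoping: v - v P^n is the sum of v (I - P) P^k over k < n, and multiplication by P
  does not increase the norm.\<close>

lemma norm1_diff_matpow_le: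
  fixes P :: "real^'n^'n::finite"
  assumes P: "stochastic_matrix P"
  shows "norm1 (v - v v* matpow P n) \<le> n * norm1 (v v* (mat 1 - P))"
proof (induction n)
  case 0
  then show ?case by (simp add: norm1_def)
next
  case (Suc n)
  have "v - v v* matpow P (Suc n) = v v* (mat 1 - P) + (v - v v* matpow P n) v* P"
    by (simp add: vector_matrix_mul_assoc[symmetric] algebra_simps)
  then have "norm1 (v - v v* matpow P (Suc n))
    \<le> norm1 (v v* (mat 1 - P)) + norm1 ((v - v v* matpow P n) v* P)"
    by (simp add: norm1_add_le)
  also have "norm1 ((v - v v* matpow P n) v* P) \<le> norm1 (v - v v* matpow P n)"
    using norm1_vector_matrix_mult_le[of P 0] P by (simp add: stochastic_matrix_def)
  finally show ?case using Suc by (simp add: algebra_simps)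
qed

text \<open>Bounded inverse of I - P on zero-sum vectors: the n-th power contracts them by
  \<open>1 - \<eta>\<close>, and that share of the norm is absorbed on the left.\<close>

lemma norm1_le_generator:
  fixes P :: "real^'n^'n::finite"
  assumes P: "stochastic_matrix P" and \<eta>: "0 < \<eta>" "\<And>i j. \<eta> \<le> matpow P n $ i $ j"
    and v: "entry_sum v = 0"
  shows "norm1 v \<le> n / \<eta> * norm1 (v v* (mat 1 - P))"
proof -
  have "norm1 v \<le> norm1 (v - v v* matpow P n) + norm1 (v v* matpow P n)"
    using norm1_add_le[of "v - v v* matpow P n" "v v* matpow P n"] by simp
  also have "\<dots> \<le> n * norm1 (v v* (mat 1 - P)) + (1 - \<eta>) * norm1 v"
    using \<eta> v by (intro add_mono norm1_diff_matpow_le norm1_vector_matrix_mult_le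
        stochastic_matrix_matpow P) auto
  finally show ?thesis using \<eta> by (simp add: field_simps)
qed

text \<open>Both sides start at 0, and a move M adds M (I - P) to each.\<close>

lemma rlgl_H_generator: "rlgl_H P M0 G t v* (mat 1 - P) = - rlgl_C P M0 G t"
proof (induction t)
  case (Suc t)
  then show ?case by (simp add: scaleR_vector_matrix_assoc vector_matrix_mult_def vec_eq_iff sum.distrib distrib_right distrib_left)
qed simp

text \<open>The error is zero-sum, as both vectors sum to 1. Since I - P annihilates
  \<open>\<pi>\<close>, it maps the error to minus the cash divided by the total of H.\<close>

lemma rlgl_estimate_error_le:
  fixes P :: "real^'n^'n::finite"
  assumes P: "stochastic_matrix P" and \<eta>: "0 < \<eta>" "\<And>i j. \<eta> \<le> matpow P n $ i $ j"
    and \<pi>: "stationary_distribution P \<pi>" and w: "w > 0" "w \<le> \<bar>entry_sum (rlgl_H P M0 G t)\<bar>"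
  shows "norm1 (rlgl_estimate P M0 G t - \<pi>) \<le> n / \<eta> / w * norm1 (rlgl_C P M0 G t)"
proof -
  define h where "h = entry_sum (rlgl_H P M0 G t)"
  define v where "v = rlgl_estimate P M0 G t - \<pi>"
  have "h \<noteq> 0" using w by (auto simp: h_def)
  then have "entry_sum (rlgl_estimate P M0 G t) = 1"
    by (simp add: rlgl_estimate_def entry_sum_def h_def sum_divide_distrib[symmetric])
  then have "entry_sum v = 0"
    using \<pi> by (simp add: v_def entry_sum_def sum_subtractf stationary_distribution_def prob_vector_def)
  have "\<pi> v* (mat 1 - P) = 0"
    using \<pi> by (simp add: stationary_distribution_def algebra_simps)
  then have "v v* (mat 1 - P) = (- 1 / h) *\<^sub>R rlgl_C P M0 G t"
    by (simp add: v_def rlgl_estimate_def vector_matrix_mult_diff_distrib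
        scaleR_vector_matrix_assoc rlgl_H_generator h_def)
  then have "norm1 (v v* (mat 1 - P)) = norm1 (rlgl_C P M0 G t) / \<bar>h\<bar>"
    by (simp only: norm1_scaleR) simp
  also have "\<dots> \<le> norm1 (rlgl_C P M0 G t) / w"
    using w by (intro divide_left_mono norm1_nonneg) (auto simp: h_def)
  finally have "norm1 (v v* (mat 1 - P)) \<le> norm1 (rlgl_C P M0 G t) / w" .
  then have "n / \<eta> * norm1 (v v* (mat 1 - P)) \<le> n / \<eta> * (norm1 (rlgl_C P M0 G t) / w)"
    using \<eta> by (intro mult_left_mono) auto
  with norm1_le_generator[OF P \<eta> \<open>entry_sum v = 0\<close>] show ?thesis
    by (simp add: v_def mult.commute)
qed

text \<open>An almost surely positive infimum need not have a deterministic lower bound. The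
  exceptional events decrease to a null set, so continuity from above provides such a bound outside
  an event of small probability.\<close>

lemma (in prob_space) prob_eventually_bounded_below:
  fixes h :: "nat \<Rightarrow> 'a \<Rightarrow> real"
  assumes [measurable]: "\<And>t. t \<ge> 1 \<Longrightarrow> h t \<in> borel_measurable M"
    and pos: "AE \<omega> in M. (INF t\<in>{1..}. \<bar>h t \<omega>\<bar>) > 0"
  shows "(\<lambda>m. prob {\<omega> \<in> space M. \<exists>t\<ge>1. \<bar>h t \<omega>\<bar> < 1 / Suc m}) \<longlonglongrightarrow> 0"
proof -
  define B where "B = (\<lambda>m. {\<omega> \<in> space M. \<exists>t\<ge>1. \<bar>h t \<omega>\<bar> < 1 / Suc m})"
  have B: "B m \<in> events" for m
  proof -
    have "B m = (\<Union>t\<in>{1..}. {\<omega> \<in> space M. \<bar>h t \<omega>\<bar> < 1 / Suc m})"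
      by (auto simp: B_def)
    also have "\<dots> \<in> events"
      by (intro sets.countable_UN') auto
    finally show ?thesis .
  qed
  have "decseq B"
  proof (rule decseq_SucI)
    fix m
    have "1 / real (Suc (Suc m)) \<le> 1 / real (Suc m)" by (simp add: frac_le)
    then show "B (Suc m) \<subseteq> B m" unfolding B_def by (blast intro: less_le_trans)
  qed
  with B have "(\<lambda>m. prob (B m)) \<longlonglongrightarrow> prob (\<Inter>m. B m)"
    by (intro finite_Lim_measure_decseq) auto
  also have "prob (\<Inter>m. B m) = 0"
  proof -
    have "AE \<omega> in M. \<omega> \<notin> (\<Inter>m. B m)"
      using pos
    proof eventually_elim
      case (elim \<omega>)
      then obtain m where m: "1 / real (Suc m) < (INF t\<in>{1..}. \<bar>h t \<omega>\<bar>)"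
        using reals_Archimedean by (metis inverse_eq_divide)
      have "(INF t\<in>{1..}. \<bar>h t \<omega>\<bar>) \<le> \<bar>h t \<omega>\<bar>" if "t \<ge> 1" for t
        using that by (intro cINF_lower bdd_belowI[of _ 0]) auto
      with m have "\<omega> \<notin> B m" unfolding B_def by force
      then show ?case by blast
    qed
    then show ?thesis
      using B by (intro prob_eq_0[THEN iffD2]) auto
  qed
  finally show ?thesis unfolding B_def .
qed

section \<open>Markov's inequality for the cash and its transfer to the estimate\<close>

theorem theorem13:
  fixes P :: "real^'n^'n::finite"
    and \<pi> M0 :: "real^'n"
    and \<Omega> :: "'w measure"
    and U :: "nat \<Rightarrow> 'w \<Rightarrow> 'n"
    and \<eta> :: real
    and r :: nat
    and f :: "nat \<Rightarrow> real"
  assumes "CARD('n) > 2"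
    and "stochastic_matrix P" and "irreducible_matrix P" and "aperiodic_matrix P"
    and "stationary_distribution P \<pi>"
    and "prob_vector M0"
    and "prob_space \<Omega>"
    and "prob_space.indep_vars \<Omega> (\<lambda>_. count_space UNIV) U {1..}"
    and "\<And>t. t \<ge> 1 \<Longrightarrow> distr \<Omega> (count_space UNIV) (U t) = uniform_count_measure UNIV"
    and "0 < \<eta>" and "\<eta> < 1" and "r \<ge> 1"
    and "\<And>r' i j. r' > r \<Longrightarrow> matpow P r' $ i $ j > \<eta>"
    and "\<And>t. f t > 0" and "filterlim f at_top sequentially"
  shows "((\<lambda>t. measure \<Omega> {\<omega> \<in> space \<Omega>.
             norm1 (rlgl_C P M0 (single_green U \<omega>) t)
               \<le> f t * exp (- rate CARD('n) r \<eta> * real t)}) \<longlonglongrightarrow> 1)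
       \<and> ((AE \<omega> in \<Omega>. (INF t\<in>{1..}. \<bar>entry_sum (rlgl_H P M0 (single_green U \<omega>) t)\<bar>) > 0)
          \<longrightarrow> bigO_prob \<Omega>
                (\<lambda>t \<omega>. norm1 (rlgl_estimate P M0 (single_green U \<omega>) t - \<pi>))
                (\<lambda>t. f t * exp (- rate CARD('n) r \<eta> * real t)))"
proof -
  interpret prob_space \<Omega> by fact
  note P = \<open>stochastic_matrix P\<close>
  define a where "a = rate CARD('n) r \<eta>"
  define g where "g = (\<lambda>t. f t * exp (- a * real t))"
  define c where "c = (\<lambda>t \<omega>. norm1 (rlgl_C P M0 (single_green U \<omega>) t))"
  have g: "g t > 0" for t using assms(14) by (simp add: g_def)
  have U [measurable]: "U s \<in> \<Omega> \<rightarrow>\<^sub>M count_space UNIV" if "s \<ge> 1" for s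
    using assms(8) that by (auto simp: indep_vars_def)
  have c_int: "integrable \<Omega> (c t)" for t
    unfolding c_def by (rule integrable_rlgl_C) (use U in auto)
  then have [measurable]: "c t \<in> borel_measurable \<Omega>" for t by blast

  obtain B where B: "B > 0"
    "\<And>t. mean_norm1 P t (- (M0 v* (mat 1 - P))) \<le> B * exp (- a * real t)"
    using mean_norm1_decay[OF assms(1,2,6,10-13)] unfolding a_def by blast
  \<comment> \<open>Only \<open>t\<close> random lights act before time \<open>Suc t\<close>; this
    shift produces the factor \<open>exp a\<close> in \<open>bad\<close>.\<close>
  have Ec: "expectation (c (Suc t)) \<le> B * exp (- a * real t)" for t
    using expectation_mean_norm1[OF assms(8,9), of P 0 M0 t] B(2)[of t] by (simp add: c_def)
  have bad: "prob {\<omega> \<in> space \<Omega>. c (Suc t) \<omega> > g (Suc t)} \<le> B * exp a / f (Suc t)" for t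
  proof -
    have "prob {\<omega> \<in> space \<Omega>. c (Suc t) \<omega> > g (Suc t)} \<le> prob {\<omega> \<in> space \<Omega>. c (Suc t) \<omega> \<ge> g (Suc t)}"
      by (intro finite_measure_mono) auto
    also have "\<dots> \<le> expectation (c (Suc t)) / g (Suc t)"
      using g by (intro integral_Markov_inequality_measure[where A = "{}"] c_int)
        (auto simp: c_def norm1_nonneg)
    also have "\<dots> \<le> B * exp (- a * real t) / g (Suc t)"
      using g[of "Suc t"] by (intro divide_right_mono Ec) auto
    also have "\<dots> = B * exp a / f (Suc t)"
      using assms(14)[of "Suc t"] by (simp add: g_def field_simps exp_minus exp_add)
    finally show ?thesis .
  qed
  have "(\<lambda>t. B * exp a / f t) \<longlonglongrightarrow> 0"
    by (intro tendsto_divide_0[OF tendsto_const] filterlim_at_top_imp_at_infinity assms)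
  then have "(\<lambda>t. B * exp a / f (Suc t)) \<longlonglongrightarrow> 0"
    by (rule LIMSEQ_Suc)
  then have "(\<lambda>t. prob {\<omega> \<in> space \<Omega>. c (Suc t) \<omega> > g (Suc t)}) \<longlonglongrightarrow> 0"
    by (rule tendsto_0_le[where K = 1]) (use bad B(1) assms(14) in \<open>auto simp: abs_of_pos intro!: always_eventually\<close>)
  then have bad_lim: "(\<lambda>t. prob {\<omega> \<in> space \<Omega>. c t \<omega> > g t}) \<longlonglongrightarrow> 0"
    by (rule LIMSEQ_imp_Suc)
  have "prob {\<omega> \<in> space \<Omega>. c t \<omega> \<le> g t} = 1 - prob {\<omega> \<in> space \<Omega>. c t \<omega> > g t}" for t
  proof -
    have "{\<omega> \<in> space \<Omega>. c t \<omega> \<le> g t} = space \<Omega> - {\<omega> \<in> space \<Omega>. c t \<omega> > g t}" by auto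
    then show ?thesis by (simp add: prob_compl)
  qed
  then have part1: "(\<lambda>t. prob {\<omega> \<in> space \<Omega>. c t \<omega> \<le> g t}) \<longlonglongrightarrow> 1"
    using tendsto_diff[OF tendsto_const bad_lim, of 1] by simp

  have part2: "bigO_prob \<Omega> (\<lambda>t \<omega>. norm1 (rlgl_estimate P M0 (single_green U \<omega>) t - \<pi>)) g"
    if pos: "AE \<omega> in \<Omega>. (INF t\<in>{1..}. \<bar>entry_sum (rlgl_H P M0 (single_green U \<omega>) t)\<bar>) > 0"
    unfolding bigO_prob_def
  proof (intro allI impI)
    fix \<epsilon> :: real assume \<epsilon>: "\<epsilon> > 0"
    define h where "h = (\<lambda>t \<omega>. entry_sum (rlgl_H P M0 (single_green U \<omega>) t))"
    define A where "A = (\<lambda>m. {\<omega> \<in> space \<Omega>. \<exists>t\<ge>1. \<bar>h t \<omega>\<bar> < 1 / Suc m})"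
    have h [measurable]: "h t \<in> borel_measurable \<Omega>" for t
    proof -
      have [measurable]: "(\<lambda>\<omega>. rlgl_H P M0 (single_green U \<omega>) t) \<in> borel_measurable \<Omega>"
        using U by (intro borel_measurable_rlgl_H) auto
      show ?thesis unfolding h_def by measurable
    qed
    have [measurable]: "A m \<in> events" for m
      unfolding A_def by measurable
    have "(\<lambda>m. prob (A m)) \<longlonglongrightarrow> 0"
      unfolding A_def by (rule prob_eventually_bounded_below) (use h pos in \<open>auto simp: h_def\<close>)
    then have "\<forall>\<^sub>F m in sequentially. prob (A m) < \<epsilon> / 2"
      using \<epsilon> by (intro order_tendstoD(2)) auto
    then obtain m where m: "prob (A m) < \<epsilon> / 2" by (auto simp: eventually_sequentially)
    have "\<forall>\<^sub>F t in sequentially. prob {\<omega> \<in> space \<Omega>. c t \<omega> > g t} < \<epsilon> / 2"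
      using \<epsilon> bad_lim by (intro order_tendstoD(2)) auto
    then obtain t0 where t0: "\<And>t. t \<ge> t0 \<Longrightarrow> prob {\<omega> \<in> space \<Omega>. c t \<omega> > g t} < \<epsilon> / 2"
      by (auto simp: eventually_sequentially)
    define w where "w = 1 / real (Suc m)"
    \<comment> \<open>\<open>Suc r\<close> is the first power beyond \<open>r\<close>, so its
      entries exceed \<open>\<eta>\<close>; \<open>w\<close> bounds the absolute total of H from
      below outside \<open>A m\<close>.\<close>
    define K where "K = real (Suc r) / \<eta> / w"
    have w: "w > 0" by (simp add: w_def)
    then have K: "K \<ge> 0" using assms(10) by (simp add: K_def)
    show "\<exists>K t0. \<forall>t\<ge>t0. prob {\<omega> \<in> space \<Omega>.
        \<bar>norm1 (rlgl_estimate P M0 (single_green U \<omega>) t - \<pi>)\<bar> > K * g t} \<le> \<epsilon>"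
    proof (intro exI allI impI)
      fix t assume t: "max 1 t0 \<le> t"
      let ?D = "\<lambda>\<omega>. norm1 (rlgl_estimate P M0 (single_green U \<omega>) t - \<pi>)"
      have "{\<omega> \<in> space \<Omega>. \<bar>?D \<omega>\<bar> > K * g t} \<subseteq> A m \<union> {\<omega> \<in> space \<Omega>. c t \<omega> > g t}"
      proof
        fix \<omega> assume \<omega>: "\<omega> \<in> {\<omega> \<in> space \<Omega>. \<bar>?D \<omega>\<bar> > K * g t}"
        show "\<omega> \<in> A m \<union> {\<omega> \<in> space \<Omega>. c t \<omega> > g t}"
        proof (cases "\<omega> \<in> A m")
          case False
          then have "w \<le> \<bar>entry_sum (rlgl_H P M0 (single_green U \<omega>) t)\<bar>"
            using \<omega> t by (auto simp: A_def h_def w_def not_less)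
          then have "?D \<omega> \<le> K * c t \<omega>"
            unfolding K_def c_def
            using rlgl_estimate_error_le[OF P assms(10) _ assms(5) w] less_imp_le[OF assms(13)] by blast
          then have "K * g t < K * c t \<omega>" using \<omega> by (simp add: norm1_nonneg)
          then show ?thesis using K \<omega> by (auto simp: mult_less_cancel_left)
        qed simp
      qed
      then have "prob {\<omega> \<in> space \<Omega>. \<bar>?D \<omega>\<bar> > K * g t} \<le> prob (A m \<union> {\<omega> \<in> space \<Omega>. c t \<omega> > g t})"
        by (intro finite_measure_mono) auto
      also have "\<dots> \<le> prob (A m) + prob {\<omega> \<in> space \<Omega>. c t \<omega> > g t}"
        by (intro measure_Un_le) auto
      finally show "prob {\<omega> \<in> space \<Omega>. \<bar>?D \<omega>\<bar> > K * g t} \<le> \<epsilon>"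
        using m t0[of t] t by simp
    qed
  qed
  show ?thesis
    using part1 part2 unfolding c_def g_def a_def by blast
qed

end
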